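(* The unit basis $(u_n)_n$ of the space $Z_{\mathrm{RUC}}$ is a weakly null RUC basis without unconditional subsequences.
   Context: RUC: for vectors $y_1,\dots,y_n$ put $\mathbb E_\varepsilon\|\sum_{i=1}^n\varepsilon_iy_i\|=2^{-n}\sum_{\varepsilon\in\{-1,1\}^n}\|\sum_{i=1}^n\varepsilon_iy_i\|$. A basic sequence $(x_n)_n$ is RUC if there is a constant $C$ such that $\mathbb E_\varepsilon\|\sum_{i=1}^n\varepsilon_ia_ix_i\|\le C\|\sum_{i=1}^na_ix_i\|$ for all $n$ and all scalars $(a_i)_{i=1}^n$. The Maurey–Rosenthal norm: fix $\delta\in(0,1)$ and an increasing sequence of positive integers $M=\{m_n\}_{n\ge1}$ such that $\sum_j\sum_{k\ne j}\sqrt{\min\{m_j/m_k,\,m_k/m_j\}}\le\delta$. Let $\mathbb N^{<\infty}$ be the collection of finite subsets of $\mathbb N$, write $\sharp s$ for the cardinality of $s$, write $s<t$ if $\max s<\min t$, and let $\mathcal S=\{s\in\mathbb N^{<\infty}:\sharp s\le\min s\}$ be the Schreier family. Fix a one-to-one function $\sigma:\mathbb N^{<\infty}\to\{m_k\}_{k\ge2}$ with $\sigma(s)>\sharp s$ for all $s$. Let $\mathcal B_0$ be the set of finite sequences $(s_1,\dots,s_n)$ of finite subsets of $\mathbb N$ such that $s_1\in\mathcal S$, $s_1<\dots<s_n$, $\sharp s_j\in M$ for all $j$, and $\sharp s_{i+1}=\sigma(s_1\cup\dots\cup s_i)>\sharp s_i$ for all $i<n$. Let $u_n$ be the $n$-th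 unit vector of $c_{00}$ (the space of finitely supported scalar sequences), $u_n^*$ its biorthogonal functional, $\mathcal N_0=\{\sum_{i=1}^n(\sharp s_i)^{-1/2}\sum_{j\in s_i}u_j^*:(s_1,\dots,s_n)\in\mathcal B_0\}$, and for $(a_n)_n\in c_{00}$ $$\|(a_n)_n\|_{\mathrm{MR}}=\max\Big\{\sup_{\phi\in\mathcal N_0}\Big|\Big\langle\phi,\sum_na_nu_n\Big\rangle\Big|,\ \sup_n|a_n|\Big\}.$$ The space $Z_{\mathrm{RUC}}$ is the completion of $c_{00}$ under the norm $\|(a_i)_i\|_{\mathrm{RUC}}=\|(a_i)_i\|_{\mathrm{MR}}+\mathbb E_\varepsilon\|(\varepsilon_ia_i)_i\|_{\mathrm{MR}}$. *)

theory Defs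
  imports "HOL-Analysis.Analysis"
begin

text \<open>
  Indexing convention: positive integers are coded by \<^typ>\<open>nat\<close> with a shift, so the index \<open>i\<close>
  stands for the positive integer \<open>i + 1\<close>.  Hence \<open>m 0, m 1, \<dots>\<close> are $m_1, m_2, \dots$, and a
  finite set \<open>s :: nat set\<close> stands for the set of all \<open>i + 1\<close> with \<open>i \<in> s\<close>.
  Scalars are real.
\<close>

subsection \<open>Bases and related notions in a Banach space\<close>

definition schauder_basis :: "'a::banach set \<Rightarrow> (nat \<Rightarrow> 'a) \<Rightarrow> bool" where
  "schauder_basis Z x \<longleftrightarrow> range x \<subseteq> Z \<and> (\<forall>z\<in>Z. \<exists>!a. (\<lambda>i. a i *\<^sub>R x i) sums z)"

definition basic_sequence :: "(nat \<Rightarrow> 'a::banach) \<Rightarrow> bool" where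
  "basic_sequence x \<longleftrightarrow> schauder_basis (closure (span (range x))) x"

text \<open>The average over all choices of signs on a finite index set \<open>A\<close>.\<close>

definition sign_avg :: "nat set \<Rightarrow> ((nat \<Rightarrow> real) \<Rightarrow> real) \<Rightarrow> real" where
  "sign_avg A F = (\<Sum>\<epsilon>\<in>A \<rightarrow>\<^sub>E {-1, 1}. F \<epsilon>) / 2 ^ card A"

definition RUC :: "(nat \<Rightarrow> 'a::banach) \<Rightarrow> bool" where
  "RUC x \<longleftrightarrow> basic_sequence x \<and>
     (\<exists>C. \<forall>n. \<forall>a :: nat \<Rightarrow> real.
        sign_avg {..<n} (\<lambda>\<epsilon>. norm (\<Sum>i<n. \<epsilon> i *\<^sub>R a i *\<^sub>R x i)) \<le> C * norm (\<Sum>i<n. a i *\<^sub>R x i))"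

text \<open>
  Unconditional convergence of a series is \<^const>\<open>summable_on\<close>, i.e. convergence along the net of
  finite sets of indices.
\<close>

definition unconditional_basic_sequence :: "(nat \<Rightarrow> 'a::banach) \<Rightarrow> bool" where
  "unconditional_basic_sequence x \<longleftrightarrow> basic_sequence x \<and>
     (\<forall>a :: nat \<Rightarrow> real. summable (\<lambda>i. a i *\<^sub>R x i) \<longrightarrow> (\<lambda>i. a i *\<^sub>R x i) summable_on UNIV)"

text \<open>
  Bounded linear functionals on a subspace \<open>Z\<close>; the values of \<open>f\<close> outside \<open>Z\<close> are irrelevant.
\<close>

definition bounded_functional_on :: "'a::real_normed_vector set \<Rightarrow> ('a \<Rightarrow> real) \<Rightarrow> bool" where
  "bounded_functional_on Z f \<longleftrightarrow>
     (\<forall>x\<in>Z. \<forall>y\<in>Z. f (x + y) = f x + f y) \<and>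
     (\<forall>c. \<forall>x\<in>Z. f (c *\<^sub>R x) = c * f x) \<and>
     (\<exists>K. \<forall>x\<in>Z. \<bar>f x\<bar> \<le> K * norm x)"

definition weakly_null :: "'a::real_normed_vector set \<Rightarrow> (nat \<Rightarrow> 'a) \<Rightarrow> bool" where
  "weakly_null Z x \<longleftrightarrow> (\<forall>f. bounded_functional_on Z f \<longrightarrow> (\<lambda>n. f (x n)) \<longlonglongrightarrow> 0)"

subsection \<open>The space of finitely supported sequences and its completions\<close>

definition supp :: "(nat \<Rightarrow> real) \<Rightarrow> nat set" where
  "supp a = {i. a i \<noteq> 0}"

definition c00 :: "(nat \<Rightarrow> real) set" where
  "c00 = {a. finite (supp a)}"

definition unit_vec :: "nat \<Rightarrow> nat \<Rightarrow> real" where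
  "unit_vec n = (\<lambda>i. if i = n then 1 else 0)"

text \<open>
  \<open>is_completion N J Z\<close>: \<open>Z\<close> together with \<open>J\<close> is a completion of \<^const>\<open>c00\<close> under the norm \<open>N\<close>,
  that is, \<open>Z\<close> is a Banach space and \<open>J\<close> a linear isometry from \<^const>\<open>c00\<close> onto a dense subspace
  of \<open>Z\<close>.  This determines \<open>Z\<close> up to isometric isomorphism.  As the norm depends on parameters and
  types cannot, \<open>Z\<close> is a closed subspace of some ambient Banach space (possibly all of it); only
  the restriction of \<open>J\<close> to \<^const>\<open>c00\<close> matters.
\<close>

definition is_completion ::
    "((nat \<Rightarrow> real) \<Rightarrow> real) \<Rightarrow> ((nat \<Rightarrow> real) \<Rightarrow> 'a::banach) \<Rightarrow> 'a set \<Rightarrow> bool" where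
  "is_completion N J Z \<longleftrightarrow>
     (\<forall>a\<in>c00. \<forall>b\<in>c00. J (\<lambda>i. a i + b i) = J a + J b) \<and>
     (\<forall>c. \<forall>a\<in>c00. J (\<lambda>i. c * a i) = c *\<^sub>R J a) \<and>
     (\<forall>a\<in>c00. norm (J a) = N a) \<and>
     closure (J ` c00) = Z"

subsection \<open>The Maurey--Rosenthal norm\<close>

definition ratio_term :: "(nat \<Rightarrow> nat) \<Rightarrow> nat \<Rightarrow> nat \<Rightarrow> real" where
  "ratio_term m j k = sqrt (min (real (m j) / real (m k)) (real (m k) / real (m j)))"

definition lacunary :: "(nat \<Rightarrow> nat) \<Rightarrow> real \<Rightarrow> bool" where
  "lacunary m \<delta> \<longleftrightarrow>
     (\<forall>j. ratio_term m j summable_on (UNIV - {j})) \<and>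
     (\<lambda>j. \<Sum>\<^sub>\<infinity>k\<in>UNIV - {j}. ratio_term m j k) summable_on UNIV \<and>
     (\<Sum>\<^sub>\<infinity>j. \<Sum>\<^sub>\<infinity>k\<in>UNIV - {j}. ratio_term m j k) \<le> \<delta>"

text \<open>The minimum of the coded set of positive integers is \<open>Min s + 1\<close>.\<close>

definition schreier :: "nat set set" where
  "schreier = {s. finite s \<and> (s \<noteq> {} \<longrightarrow> card s \<le> Min s + 1)}"

text \<open>All members of a list in \<open>B0 m \<sigma>\<close> are nonempty, as the numbers \<open>m k\<close> are positive.\<close>

definition B0 :: "(nat \<Rightarrow> nat) \<Rightarrow> (nat set \<Rightarrow> nat) \<Rightarrow> nat set list set" where
  "B0 m \<sigma> = {ss. ss \<noteq> [] \<and> (\<forall>s\<in>set ss. finite s \<and> card s \<in> range m) \<and>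
     hd ss \<in> schreier \<and>
     (\<forall>i. Suc i < length ss \<longrightarrow>
        Max (ss ! i) < Min (ss ! Suc i) \<and>
        card (ss ! Suc i) = \<sigma> (\<Union> (set (take (Suc i) ss))) \<and>
        card (ss ! i) < \<sigma> (\<Union> (set (take (Suc i) ss))))}"

definition N0 :: "(nat \<Rightarrow> nat) \<Rightarrow> (nat set \<Rightarrow> nat) \<Rightarrow> ((nat \<Rightarrow> real) \<Rightarrow> real) set" where
  "N0 m \<sigma> = (\<lambda>ss a. \<Sum>i<length ss. (1 / sqrt (real (card (ss ! i)))) * (\<Sum>j\<in>ss ! i. a j)) ` B0 m \<sigma>"

definition MR_norm :: "(nat \<Rightarrow> nat) \<Rightarrow> (nat set \<Rightarrow> nat) \<Rightarrow> (nat \<Rightarrow> real) \<Rightarrow> real" where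
  "MR_norm m \<sigma> a = max (SUP \<phi>\<in>N0 m \<sigma>. \<bar>\<phi> a\<bar>) (SUP n. \<bar>a n\<bar>)"

text \<open>
  Signs outside the support of \<open>a\<close> do not affect \<open>\<epsilon> i * a i\<close>, so it suffices to average over the
  signs on the support.
\<close>

definition RUC_norm :: "(nat \<Rightarrow> nat) \<Rightarrow> (nat set \<Rightarrow> nat) \<Rightarrow> (nat \<Rightarrow> real) \<Rightarrow> real" where
  "RUC_norm m \<sigma> a = MR_norm m \<sigma> a + sign_avg (supp a) (\<lambda>\<epsilon>. MR_norm m \<sigma> (\<lambda>i. \<epsilon> i * a i))"

end

theory Submission
  imports Defs
begin

text \<open>
  A functional in \<^term>\<open>N0 m \<sigma>\<close> adds up the normalised sums over the sets of a \<^emph>\<open>chain\<close>: successive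
  sets whose cardinalities, from the second on, are codes of everything before.  The cardinalities of
  distinct sets of a chain are distinct members of \<^term>\<open>m\<close>, so by lacunarity a functional sees
  the different scales almost independently.  This makes the functionals small on spread-out vectors.

  \<^emph>\<open>Basis.\<close>  Only the first set of a chain is subject to the Schreier condition, which bounds the
  minimum from below and hence is not spoiled by pushing points to the right.  The restriction of a
  functional to an initial segment therefore acts on a finitely supported vector like another
  functional of the same kind: the last set is cut and completed by far away points
  (\<open>chain_fun_cut\<close>).  So the partial sum projections are contractions in both parts of the norm,
  which makes the unit vectors a basis (\<open>schauder_basisI_projections\<close>).

  \<^emph>\<open>RUC.\<close>  The second summand of the norm is invariant under sign changes of the coordinates and is
  the average over the signs of the first one.  Averaging the whole norm thus gives twice the second
  summand (\<open>sign_avg_RUC_norm_le\<close>).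

  \<^emph>\<open>Weakly null.\<close>  A vector with \<^term>\<open>m p\<close> coordinates of modulus at most one and zeros elsewhere
  has norm at most four times \<^term>\<open>sqrt (m p)\<close> (\<open>RUC_norm_flat_le\<close>).  A functional that is bounded
  away from zero on infinitely many unit vectors would be of order \<^term>\<open>m p\<close> on such a vector.

  \<^emph>\<open>No unconditional subsequence.\<close>  Inside the range of any subsequence there is an infinite chain
  $s_0 < s_1 < \dots$ (\<open>infinite_chain_exists\<close>).  Put $y_a = (\sharp s_a)^{-1/2} 1_{s_a}$.  As
  \<^term>\<open>\<sigma>\<close> is injective, the cardinality of a set determines its whole past
  (\<open>chain_decode\<close>): any other chain follows $(s_a)$ up to some point and has
  at most three sets whose cardinality matches one of $(s_a)$ otherwise.  Hence a functional on
  $\sum_a c_a y_a$ is a partial sum of $(c_a)$ up to an error of the order of $\max_a |c_a|$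
  (\<open>chain_fun_block_le\<close>).  After random changes of the signs of the coordinates the leading term
  becomes a sum of averages of many independent signs, which is of the order of the error, since the
  cardinalities increase fast.  The norm of $\sum_a c_a y_a$ is therefore comparable with
  $\sup_l |\sum_{a<l} c_a|$, and the coefficients of a conditionally convergent series of real numbers
  yield a conditionally convergent series in the space.
\<close>

section \<open>Averages over signs\<close>

lemma sign_avg_empty: "sign_avg {} F = F (\<lambda>_. undefined)"
  by (simp add: sign_avg_def)

lemma sign_avg_insert:
  assumes "finite A" "x \<notin> A"
  shows "sign_avg (insert x A) F =
    (sign_avg A (\<lambda>\<epsilon>. F (\<epsilon>(x := 1))) + sign_avg A (\<lambda>\<epsilon>. F (\<epsilon>(x := -1)))) / 2"
proof -
  let ?P = "A \<rightarrow>\<^sub>E {-1, 1::real}"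
  have "(\<Sum>\<epsilon>\<in>insert x A \<rightarrow>\<^sub>E {-1, 1}. F \<epsilon>) = (\<Sum>(y, g)\<in>{-1, 1} \<times> ?P. F (g(x := y)))"
    unfolding PiE_insert_eq
    by (subst sum.reindex) (use inj_combinator[OF assms(2), of "\<lambda>_. {-1, 1::real}"] in \<open>auto simp: case_prod_beta\<close>)
  also have "\<dots> = (\<Sum>g\<in>?P. F (g(x := -1))) + (\<Sum>g\<in>?P. F (g(x := 1)))"
    by (simp add: sum.cartesian_product[symmetric])
  finally show ?thesis
    using assms by (simp add: sign_avg_def field_simps)
qed

lemma sign_avg_mono:
  assumes "\<And>\<epsilon>. \<epsilon> \<in> A \<rightarrow>\<^sub>E {-1, 1} \<Longrightarrow> F \<epsilon> \<le> G \<epsilon>"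
  shows "sign_avg A F \<le> sign_avg A G"
  unfolding sign_avg_def by (intro divide_right_mono sum_mono assms) auto

lemma sign_avg_cong:
  assumes "\<And>\<epsilon>. \<epsilon> \<in> A \<rightarrow>\<^sub>E {-1, 1} \<Longrightarrow> F \<epsilon> = G \<epsilon>"
  shows "sign_avg A F = sign_avg A G"
  by (simp add: sign_avg_def assms)

lemma sign_avg_add: "sign_avg A (\<lambda>\<epsilon>. F \<epsilon> + G \<epsilon>) = sign_avg A F + sign_avg A G"
  by (simp add: sign_avg_def sum.distrib add_divide_distrib)

lemma sign_avg_scale: "sign_avg A (\<lambda>\<epsilon>. c * F \<epsilon>) = c * sign_avg A F"
  by (simp add: sign_avg_def sum_distrib_left)

lemma sign_avg_sum: "sign_avg A (\<lambda>\<epsilon>. \<Sum>i\<in>I. F i \<epsilon>) = (\<Sum>i\<in>I. sign_avg A (F i))"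
  by (simp add: sign_avg_def sum.swap[of _ I] sum_divide_distrib)

lemma sign_avg_const:
  assumes "finite A"
  shows "sign_avg A (\<lambda>_. c) = c"
  using assms by (simp add: sign_avg_def card_PiE numeral_2_eq_2)

text \<open>
  A coordinate on which the integrand does not depend contributes two equal halves to the recursion
  over the index set.
\<close>

lemma sign_avg_superset:
  assumes "finite B" "A \<subseteq> B"
    and local: "\<And>\<epsilon> \<epsilon>'. (\<forall>i\<in>A. \<epsilon> i = \<epsilon>' i) \<Longrightarrow> F \<epsilon> = F \<epsilon>'"
  shows "sign_avg B F = sign_avg A F"
proof -
  have fA: "finite A" using assms finite_subset by blast
  have "finite C \<Longrightarrow> C \<inter> A = {} \<Longrightarrow> sign_avg (C \<union> A) F = sign_avg A F" for C
  proof (induction C rule: finite_induct)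
    case (insert x C)
    have "F (\<epsilon>(x := s)) = F \<epsilon>" for \<epsilon> s
      using insert.prems by (intro local) auto
    then show ?case
      using insert fA by (simp add: sign_avg_insert)
  qed simp
  from this[of "B - A"] show ?thesis
    using assms by (simp add: Int_commute Un_absorb2)
qed

text \<open>
  Multiplication by a fixed choice of signs permutes the choices of signs; in the recursion it only
  exchanges the two halves.
\<close>

lemma sign_avg_sign_change:
  assumes "finite A" "\<And>i. i \<in> A \<Longrightarrow> \<eta> i \<in> {-1, 1}"
    and "\<And>\<epsilon> \<epsilon>'. (\<forall>i\<in>A. \<epsilon> i = \<epsilon>' i) \<Longrightarrow> F \<epsilon> = F \<epsilon>'"
  shows "sign_avg A (\<lambda>\<epsilon>. F (\<lambda>i. \<epsilon> i * \<eta> i)) = sign_avg A F"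
  using assms
proof (induction A arbitrary: F rule: finite_induct)
  case empty
  have "F (\<lambda>i. undefined * \<eta> i) = F (\<lambda>_. undefined)"
    by (rule empty.prems(2)) simp
  then show ?case by (simp add: sign_avg_empty)
next
  case (insert x A)
  define G where "G s = (\<lambda>\<epsilon>. F (\<epsilon>(x := s)))" for s
  have loc: "G s \<epsilon> = G s \<epsilon>'" if "\<forall>i\<in>A. \<epsilon> i = \<epsilon>' i" for s \<epsilon> \<epsilon>'
    unfolding G_def by (rule insert.prems(2)) (use that in auto)
  have IH: "sign_avg A (\<lambda>\<epsilon>. G s (\<lambda>i. \<epsilon> i * \<eta> i)) = sign_avg A (G s)" for s
    by (rule insert.IH) (use insert.prems(1) loc in auto)
  have eq: "F (\<lambda>i. (\<epsilon>(x := s)) i * \<eta> i) = G (s * \<eta> x) (\<lambda>i. \<epsilon> i * \<eta> i)" for s \<epsilon>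
    unfolding G_def by (rule arg_cong[of _ _ F]) auto
  have "\<eta> x = -1 \<or> \<eta> x = 1" using insert.prems(1)[of x] by auto
  then show ?case
    unfolding sign_avg_insert[OF insert.hyps] eq IH by (auto simp: G_def)
qed

lemma sign_avg_sum_squared:
  assumes "finite A"
  shows "sign_avg A (\<lambda>\<epsilon>. (\<Sum>k\<in>A. \<epsilon> k)\<^sup>2) = card A"
  using assms
proof (induction A rule: finite_induct)
  case (insert x A)
  define S where "S = (\<lambda>\<epsilon>::nat \<Rightarrow> real. \<Sum>k\<in>A. \<epsilon> k)"
  have "(\<Sum>k\<in>A. (\<epsilon>(x := s)) k) = S \<epsilon>" for \<epsilon> s
    unfolding S_def using insert.hyps by (intro sum.cong) auto
  then have e: "(\<Sum>k\<in>insert x A. (\<epsilon>(x := s)) k) = s + S \<epsilon>" for \<epsilon> s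
    using insert.hyps by simp
  have "sign_avg A (\<lambda>\<epsilon>. (1 + S \<epsilon>)\<^sup>2) + sign_avg A (\<lambda>\<epsilon>. (-1 + S \<epsilon>)\<^sup>2)
      = sign_avg A (\<lambda>\<epsilon>. 2 * ((S \<epsilon>)\<^sup>2 + 1))"
    unfolding sign_avg_add[symmetric] by (simp add: power2_eq_square algebra_simps)
  also have "\<dots> = 2 * (card A + 1)"
    using insert by (simp add: sign_avg_scale sign_avg_add sign_avg_const S_def)
  finally show ?case
    using insert.hyps unfolding sign_avg_insert[OF insert.hyps] e by simp
qed (simp add: sign_avg_empty)

text \<open>
  Random signs are orthonormal, so their sum over a set has second moment \<^term>\<open>card A\<close>.  This is what
  makes the average of the signs over a large set negligible.
\<close>

lemma sign_avg_abs_mean_le: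
  assumes "finite A" "A \<noteq> {}"
  shows "sign_avg A (\<lambda>\<epsilon>. \<bar>\<Sum>k\<in>A. \<epsilon> k\<bar> / card A) \<le> 1 / sqrt (card A)"
proof -
  define c where "c = sqrt (card A)"
  have c: "c > 0" "c * c = card A" using assms by (auto simp: c_def card_gt_0_iff)
  \<comment> \<open>The second moment bounds the first by the inequality of arithmetic and geometric means.\<close>
  have amgm: "\<bar>x\<bar> / card A \<le> (1 / (2 * c ^ 3)) * x\<^sup>2 + 1 / (2 * c)" for x
  proof -
    have "0 \<le> (\<bar>x\<bar> - c)\<^sup>2" by simp
    then have "2 * c * \<bar>x\<bar> \<le> x\<^sup>2 + c * c" by (simp add: power2_eq_square algebra_simps)
    then have "(2 * c * \<bar>x\<bar>) / (2 * c ^ 3) \<le> (x\<^sup>2 + c * c) / (2 * c ^ 3)"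
      using c by (intro divide_right_mono) auto
    then show ?thesis using c(1) unfolding c(2)[symmetric]
      by (simp add: add_divide_distrib power3_eq_cube)
  qed
  have "sign_avg A (\<lambda>\<epsilon>. \<bar>\<Sum>k\<in>A. \<epsilon> k\<bar> / card A)
      \<le> sign_avg A (\<lambda>\<epsilon>. (1 / (2 * c ^ 3)) * (\<Sum>k\<in>A. \<epsilon> k)\<^sup>2 + 1 / (2 * c))"
    by (intro sign_avg_mono amgm)
  also have "\<dots> = (1 / (2 * c ^ 3)) * (c * c) + 1 / (2 * c)"
    using assms by (simp only: sign_avg_add sign_avg_scale sign_avg_const sign_avg_sum_squared c)
  also have "\<dots> = 1 / c" using c(1) by (simp add: field_simps power3_eq_cube)
  finally show ?thesis by (simp add: c_def)
qed

section \<open>A criterion for basic sequences\<close>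

lemma span_range_finite_sum:
  fixes x :: "nat \<Rightarrow> 'a::real_vector"
  assumes "v \<in> span (range x)"
  obtains a n where "v = (\<Sum>i<n. a i *\<^sub>R x i)" "\<And>i. n \<le> i \<Longrightarrow> a i = 0"
proof -
  have "\<exists>a n. v = (\<Sum>i<n. a i *\<^sub>R x i) \<and> (\<forall>i\<ge>n. a i = (0::real))"
    using assms
  proof (induction rule: span_induct_alt)
    case base
    show ?case by (intro exI[of _ "\<lambda>_. 0"] exI[of _ 0]) simp
  next
    case (step c w v)
    then obtain k a n where k: "w = x k" and v: "v = (\<Sum>i<n. a i *\<^sub>R x i)" "\<forall>i\<ge>n. a i = (0::real)"
      by auto
    define N where "N = max n (Suc k)"
    have kN: "k < N" by (simp add: N_def)
    have "v = (\<Sum>i<N. a i *\<^sub>R x i)"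
      unfolding v(1) by (rule sum.mono_neutral_left) (auto simp: N_def v(2))
    moreover have "c *\<^sub>R x k = (\<Sum>i<N. (if i = k then c else 0) *\<^sub>R x i)"
      using kN by (simp add: if_distrib[of "\<lambda>r. r *\<^sub>R _"] cong: if_cong)
    ultimately have "c *\<^sub>R w + v = (\<Sum>i<N. ((if i = k then c else 0) + a i) *\<^sub>R x i)"
      by (simp add: k scaleR_add_left sum.distrib)
    moreover have "(if i = k then c else 0) + a i = 0" if "N \<le> i" for i
      using that v(2) by (auto simp: N_def)
    ultimately show ?case
      by (intro exI[of _ "\<lambda>i. (if i = k then c else 0) + a i"] exI[of _ N]) blast
  qed
  then show ?thesis using that by blast
qed

text \<open>
  Grunblum's criterion.  The bound on the partial sum projections passes to infinite expansions and
  shows that the coefficients depend continuously on the vector.  This gives uniqueness, and for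
  the limit of a sequence in the span it gives convergence of the coefficients, uniformly controlled
  in the length of the partial sums, so that their limits expand the limit vector.
\<close>

lemma schauder_basisI_projections:
  fixes x :: "nat \<Rightarrow> 'a::banach"
  assumes nz: "\<And>i. x i \<noteq> 0"
    and proj: "\<And>(a :: nat \<Rightarrow> real) p q. p \<le> q \<Longrightarrow>
      norm (\<Sum>i<p. a i *\<^sub>R x i) \<le> K * norm (\<Sum>i<q. a i *\<^sub>R x i)"
  shows "schauder_basis (closure (span (range x))) x"
proof -
  let ?S = "\<lambda>a p. \<Sum>i<p. a i *\<^sub>R x i"
  have K: "0 \<le> K"
  proof -
    have "norm (x 0) \<le> K * norm (x 0)" using proj[of 1 1 "\<lambda>_. 1"] by simp
    with nz[of 0] show ?thesis
      by (metis mult_le_cancel_right1 norm_le_zero_iff not_less order_trans zero_le_one)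
  qed
  \<comment> \<open>Coefficient functionals are differences of consecutive projections.\<close>
  have lim_proj: "norm (?S a p) \<le> K * norm z" if "(\<lambda>i. a i *\<^sub>R x i) sums z" for a z p
  proof (rule tendsto_lowerbound)
    show "(\<lambda>q. K * norm (?S a q)) \<longlonglongrightarrow> K * norm z"
      using that unfolding sums_def by (intro tendsto_intros)
    show "\<forall>\<^sub>F q in sequentially. norm (?S a p) \<le> K * norm (?S a q)"
      using eventually_ge_at_top[of p] by eventually_elim (rule proj)
  qed simp
  have coeff: "norm (a i *\<^sub>R x i) \<le> 2 * K * norm z" if "(\<lambda>i. a i *\<^sub>R x i) sums z" for a z i
  proof -
    have "a i *\<^sub>R x i = ?S a (Suc i) - ?S a i" by simp
    then have "norm (a i *\<^sub>R x i) \<le> norm (?S a (Suc i)) + norm (?S a i)"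
      using norm_triangle_ineq4 by metis
    with lim_proj[OF that, of "Suc i"] lim_proj[OF that, of i] show ?thesis by linarith
  qed
  have uniq: "a = b" if "(\<lambda>i. a i *\<^sub>R x i) sums z" "(\<lambda>i. b i *\<^sub>R x i) sums z" for a b z
  proof
    fix i
    have "(\<lambda>i. (a i - b i) *\<^sub>R x i) sums 0"
      using sums_diff[OF that] by (simp add: scaleR_diff_left)
    from coeff[OF this, of i] nz[of i] show "a i = b i" by (simp add: mult_le_0_iff)
  qed
  have ex: "\<exists>a. (\<lambda>i. a i *\<^sub>R x i) sums z" if z: "z \<in> closure (span (range x))" for z
  proof -
    obtain v where v: "\<And>k. v k \<in> span (range x)" "v \<longlonglongrightarrow> z"
      using z unfolding closure_sequential by blast
    have "\<exists>a. \<forall>k. (\<lambda>i. a k i *\<^sub>R x i) sums v k \<and> (\<exists>n. \<forall>p\<ge>n. ?S (a k) p = v k)"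
    proof (rule choice, rule)
      fix k
      obtain b n where b: "v k = ?S b n" "\<And>i. n \<le> i \<Longrightarrow> b i = (0::real)"
        using span_range_finite_sum[OF v(1)] by metis
      have "?S b p = v k" if "p \<ge> n" for p
        unfolding b(1) by (rule sum.mono_neutral_right) (use that in \<open>auto simp: b(2)\<close>)
      moreover have "(\<lambda>i. b i *\<^sub>R x i) sums v k"
        unfolding b(1) by (rule sums_finite) (auto simp: b(2))
      ultimately show "\<exists>b. (\<lambda>i. b i *\<^sub>R x i) sums v k \<and> (\<exists>n. \<forall>p\<ge>n. ?S b p = v k)"
        by blast
    qed
    then obtain a where a: "\<And>k. (\<lambda>i. a k i *\<^sub>R x i) sums v k"
      and fin: "\<And>k. \<exists>n. \<forall>p\<ge>n. ?S (a k) p = v k" by blast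
    have diff: "(\<lambda>i. (a k i - a l i) *\<^sub>R x i) sums (v k - v l)" for k l
      using sums_diff[OF a[of k] a[of l]] by (simp add: scaleR_diff_left)
    have Cv: "Cauchy v" using v(2) LIMSEQ_imp_Cauchy by blast
    have "Cauchy (\<lambda>k. a k i)" for i
    proof (rule metric_CauchyI)
      fix e :: real assume "0 < e"
      have nx: "norm (x i) > 0" using nz by simp
      define d where "d = e * norm (x i) / (2 * K + 1)"
      have d: "d > 0" using \<open>0 < e\<close> nx K by (simp add: d_def)
      obtain M where M: "\<And>k l. k \<ge> M \<Longrightarrow> l \<ge> M \<Longrightarrow> dist (v k) (v l) < d"
        using metric_CauchyD[OF Cv d] by blast
      have "dist (a k i) (a l i) < e" if "k \<ge> M" "l \<ge> M" for k l
      proof -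
        have "\<bar>a k i - a l i\<bar> * norm (x i) \<le> 2 * K * norm (v k - v l)"
          using coeff[OF diff[of k l], of i] by simp
        also have "\<dots> \<le> (2 * K) * d"
          using M[OF that] K by (intro mult_left_mono) (auto simp: dist_norm)
        also have "\<dots> < (2 * K + 1) * d" using d by simp
        also have "\<dots> = e * norm (x i)" using K by (simp add: d_def)
        finally show ?thesis using nx by (simp add: dist_real_def)
      qed
      then show "\<exists>M. \<forall>k\<ge>M. \<forall>l\<ge>M. dist (a k i) (a l i) < e" by blast
    qed
    then have "\<exists>b. (\<lambda>k. a k i) \<longlonglongrightarrow> b" for i
      using Cauchy_convergent convergent_def by blast
    then obtain b where b: "\<And>i. (\<lambda>k. a k i) \<longlonglongrightarrow> b i" by metis
    \<comment> \<open>The finite expansions of the approximants converge uniformly in the cut-off point.\<close>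
    have unif: "norm (?S (a k) p - ?S b p) \<le> K * norm (v k - z)" for k p
    proof (rule tendsto_le[OF trivial_limit_sequentially])
      show "(\<lambda>l. K * norm (v k - v l)) \<longlonglongrightarrow> K * norm (v k - z)"
        by (intro tendsto_intros v)
      show "(\<lambda>l. norm (?S (a k) p - ?S (a l) p)) \<longlonglongrightarrow> norm (?S (a k) p - ?S b p)"
        by (intro tendsto_intros b)
      show "\<forall>\<^sub>F l in sequentially. norm (?S (a k) p - ?S (a l) p) \<le> K * norm (v k - v l)"
        using lim_proj[OF diff] by (simp add: scaleR_diff_left sum_subtractf)
    qed
    have "?S b \<longlonglongrightarrow> z"
    proof (rule metric_LIMSEQ_I)
      fix e :: real assume "0 < e"
      then have "0 < e / (K + 1)" using K by simp
      from metric_LIMSEQ_D[OF v(2) this] obtain k where k: "norm (v k - z) < e / (K + 1)"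
        by (auto simp: dist_norm)
      obtain n where n: "\<And>p. p \<ge> n \<Longrightarrow> ?S (a k) p = v k" using fin by blast
      have "dist (?S b p) z < e" if "p \<ge> n" for p
      proof -
        have "dist (?S b p) z \<le> norm (?S (a k) p - ?S b p) + norm (v k - z)"
          using dist_triangle3[of "?S b p" z "v k"] n[OF that] by (simp add: dist_norm)
        also have "\<dots> \<le> (K + 1) * norm (v k - z)"
          using unif[of k p] by (simp add: algebra_simps)
        also have "\<dots> < e" using k K by (simp add: field_simps)
        finally show ?thesis .
      qed
      then show "\<exists>n. \<forall>p\<ge>n. dist (?S b p) z < e" by blast
    qed
    then show ?thesis unfolding sums_def by blast
  qed
  have "range x \<subseteq> closure (span (range x))"
    using span_superset closure_subset by (rule subset_trans)
  then show ?thesis unfolding schauder_basis_def using ex uniq by metis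
qed

section \<open>The Maurey--Rosenthal functionals and the lacunary sequence\<close>

definition chain_fun :: "(nat \<Rightarrow> nat set) \<Rightarrow> nat \<Rightarrow> (nat \<Rightarrow> real) \<Rightarrow> real" where
  "chain_fun s n a = (\<Sum>i<n. (\<Sum>j\<in>s i. a j) / sqrt (card (s i)))"

locale Maurey_Rosenthal =
  fixes \<delta> :: real and m :: "nat \<Rightarrow> nat" and \<sigma> :: "nat set \<Rightarrow> nat"
  assumes \<delta>_less: "\<delta> < 1"
    and m_mono: "strict_mono m" and m_pos: "\<And>n. 0 < m n" and m_lacunary: "lacunary m \<delta>"
    and \<sigma>_inj: "inj_on \<sigma> {s. finite s}"
    and \<sigma>_range: "\<And>s. finite s \<Longrightarrow> \<sigma> s \<in> m ` {1..}"
    and \<sigma>_card: "\<And>s. finite s \<Longrightarrow> card s < \<sigma> s"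
begin

lemma ratio_term_nonneg: "0 \<le> ratio_term m j k"
  by (simp add: ratio_term_def)

text \<open>
  In this form the ratio is a bound for the pairing of two normalised indicator functions of sets with
  \<^term>\<open>m p\<close> and \<^term>\<open>m q\<close> elements.
\<close>

lemma ratio_term_eq: "ratio_term m p q = min (real (m p)) (m q) / sqrt (real (m p) * m q)"
proof -
  define a b where "a = real (m p)" and "b = real (m q)"
  have ab: "a > 0" "b > 0" using m_pos by (auto simp: a_def b_def)
  have "sqrt (min (a / b) (b / a)) = min a b / sqrt (a * b)"
  proof (cases "a \<le> b")
    case True
    then have "a * a \<le> b * b" using ab by (intro mult_mono) auto
    then have "a / b \<le> b / a" using ab by (simp add: field_simps)
    then show ?thesis using True ab
      by (simp add: min_def real_sqrt_divide real_sqrt_mult field_simps)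
  next
    case False
    then have "b * b < a * a" using ab by (intro mult_strict_mono) auto
    then have "b / a < a / b" using ab by (simp add: field_simps)
    then show ?thesis using False ab
      by (simp add: min_def real_sqrt_divide real_sqrt_mult field_simps)
  qed
  then show ?thesis by (simp add: ratio_term_def a_def b_def)
qed

lemma ratio_term_same: "ratio_term m p p = 1"
  using m_pos[of p] by (simp add: ratio_term_def)

lemma sum_ratio_term_le:
  assumes "finite P" "\<And>j k. (j, k) \<in> P \<Longrightarrow> j \<noteq> k"
  shows "(\<Sum>(j, k)\<in>P. ratio_term m j k) \<le> \<delta>"
proof -
  let ?row = "\<lambda>j. \<Sum>\<^sub>\<infinity>k\<in>UNIV - {j}. ratio_term m j k"
  have row: "ratio_term m j summable_on (UNIV - {j})" for j
    using m_lacunary by (simp add: lacunary_def)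
  have "(\<Sum>(j, k)\<in>P. ratio_term m j k)
      \<le> (\<Sum>(j, k)\<in>(SIGMA j:fst ` P. snd ` P - {j}). ratio_term m j k)"
    using assms by (intro sum_mono2) (force simp: ratio_term_nonneg)+
  also have "\<dots> = (\<Sum>j\<in>fst ` P. \<Sum>k\<in>snd ` P - {j}. ratio_term m j k)"
    using assms by (subst sum.Sigma) auto
  also have "\<dots> \<le> (\<Sum>j\<in>fst ` P. ?row j)"
    using assms row by (intro sum_mono finite_sum_le_infsum) (auto simp: ratio_term_nonneg)
  also have "\<dots> \<le> (\<Sum>\<^sub>\<infinity>j. ?row j)"
    using assms m_lacunary
    by (intro finite_sum_le_infsum) (auto simp: lacunary_def ratio_term_nonneg infsum_nonneg)
  also have "\<dots> \<le> \<delta>" using m_lacunary by (simp add: lacunary_def)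
  finally show ?thesis .
qed

lemma sum_ratio_term_column_le:
  assumes "finite I" "inj_on f I"
  shows "(\<Sum>i\<in>I. ratio_term m (f i) p) \<le> 2"
proof -
  have f: "finite (f ` I)" using assms by simp
  have "(\<Sum>i\<in>I. ratio_term m (f i) p) = (\<Sum>j\<in>f ` I. ratio_term m j p)"
    using assms by (simp add: sum.reindex)
  also have "\<dots> \<le> (\<Sum>j\<in>insert p (f ` I - {p}). ratio_term m j p)"
    using f by (intro sum_mono2) (auto simp: ratio_term_nonneg)
  also have "\<dots> = 1 + (\<Sum>j\<in>f ` I - {p}. ratio_term m j p)"
    using f by (simp add: ratio_term_same sum.insert_remove)
  also have "(\<Sum>j\<in>f ` I - {p}. ratio_term m j p)
      = (\<Sum>(j, k)\<in>(\<lambda>j. (j, p)) ` (f ` I - {p}). ratio_term m j k)"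
    by (subst sum.reindex) (auto simp: inj_on_def)
  also have "\<dots> \<le> \<delta>"
    using f by (intro sum_ratio_term_le) auto
  finally show ?thesis using \<delta>_less by simp
qed

text \<open>
  Each pair of indices occurs in both orders in the lacunarity sum, hence \<^term>\<open>ratio_term m p q\<close> is
  below one half.
\<close>

lemma m_double:
  assumes "p < q"
  shows "2 * m p \<le> m q"
proof -
  have "(\<Sum>(j, k)\<in>{(p, q), (q, p)}. ratio_term m j k) \<le> \<delta>"
    using assms by (intro sum_ratio_term_le) auto
  then have "2 * ratio_term m p q \<le> \<delta>"
    using assms by (simp add: ratio_term_def min.commute)
  then have le: "ratio_term m p q \<le> 1 / 2" using \<delta>_less by simp
  have "m p < m q" using m_mono assms by (simp add: strict_monoD)
  then have "ratio_term m p q = sqrt (real (m p) / m q)"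
    using m_pos[of p] m_pos[of q] by (simp add: ratio_term_eq real_sqrt_divide real_sqrt_mult field_simps)
  then have "real (m p) / m q \<le> (1 / 2)\<^sup>2"
    using le by (metis real_sqrt_le_iff real_sqrt_abs abs_of_nonneg zero_le_divide_1_iff zero_le_numeral)
  then have "4 * real (m p) \<le> m q" using m_pos[of q] by (simp add: field_simps power2_eq_square)
  then show ?thesis by linarith
qed

lemma le_m: "p \<le> m p"
  using m_mono by (rule strict_mono_imp_increasing)

section \<open>Chains\<close>

text \<open>
  The lists in \<^const>\<open>B0\<close>, written as initial segments of sequences of sets, which makes it possible
  to speak of infinite chains and to modify a single set.  The strict growth of cardinalities
  follows from the coding function exceeding the cardinality of its argument.
\<close>

definition chain :: "(nat \<Rightarrow> nat set) \<Rightarrow> nat \<Rightarrow> bool" where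
  "chain s n \<longleftrightarrow> 0 < n \<and> (\<forall>i<n. finite (s i) \<and> card (s i) \<in> range m) \<and>
     (\<forall>x\<in>s 0. card (s 0) \<le> Suc x) \<and>
     (\<forall>i. Suc i < n \<longrightarrow> (\<forall>x\<in>s i. \<forall>y\<in>s (Suc i). x < y) \<and> card (s (Suc i)) = \<sigma> (\<Union>j\<le>i. s j))"

lemma chain_finite: "chain s n \<Longrightarrow> i < n \<Longrightarrow> finite (s i)"
  and chain_card_range: "chain s n \<Longrightarrow> i < n \<Longrightarrow> card (s i) \<in> range m"
  and chain_head: "chain s n \<Longrightarrow> x \<in> s 0 \<Longrightarrow> card (s 0) \<le> Suc x"
  and chain_step: "chain s n \<Longrightarrow> Suc i < n \<Longrightarrow> x \<in> s i \<Longrightarrow> y \<in> s (Suc i) \<Longrightarrow> x < y"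
  and chain_card_Suc: "chain s n \<Longrightarrow> Suc i < n \<Longrightarrow> card (s (Suc i)) = \<sigma> (\<Union>j\<le>i. s j)"
  by (auto simp: chain_def)

lemma chain_card_pos: "chain s n \<Longrightarrow> i < n \<Longrightarrow> 0 < card (s i)"
  using chain_card_range m_pos by fastforce

lemma chain_nonempty: "chain s n \<Longrightarrow> i < n \<Longrightarrow> s i \<noteq> {}"
  using chain_card_pos by fastforce

lemma chain_finite_Union: "chain s n \<Longrightarrow> i < n \<Longrightarrow> finite (\<Union>j\<le>i. s j)"
  by (auto intro: chain_finite)

lemma chain_card_Union_less:
  "chain s n \<Longrightarrow> Suc i < n \<Longrightarrow> card (\<Union>j\<le>i. s j) < card (s (Suc i))"
  using \<sigma>_card[OF chain_finite_Union] by (simp add: chain_card_Suc)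

lemma chain_card_strict_mono:
  assumes "chain s n" "j < n" "i < j"
  shows "card (s i) < card (s j)"
proof -
  obtain k where k: "j = Suc k" using assms(3) by (cases j) auto
  have "card (s i) \<le> card (\<Union>l\<le>k. s l)"
    using assms k by (intro card_mono chain_finite_Union UN_upper) auto
  also have "\<dots> < card (s j)"
    using assms k by (simp add: chain_card_Union_less)
  finally show ?thesis .
qed

lemma chain_less:
  assumes "chain s n" "i < j" "j < n" "x \<in> s i" "y \<in> s j"
  shows "x < y"
proof -
  have "Suc i \<le> j" using assms by simp
  then show ?thesis using assms(3,5)
  proof (induction j arbitrary: y rule: dec_induct)
    case base
    then show ?case using assms chain_step by blast
  next
    case (step k)
    obtain z where z: "z \<in> s k" using chain_nonempty[OF assms(1), of k] step.prems by auto
    have "x < z" using step z by simp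
    also have "z < y" using chain_step[OF assms(1) step.prems(1) z] step.prems by simp
    finally show ?case .
  qed
qed

lemma chain_disjoint:
  assumes "chain s n" "i < n" "j < n" "x \<in> s i" "x \<in> s j"
  shows "i = j"
  using assms chain_less[OF assms(1)] by (metis less_irrefl nat_neq_iff)

lemma N0_eq: "N0 m \<sigma> = {chain_fun s n | s n. chain s n}"
proof -
  have B0_iff: "map s [0..<n] \<in> B0 m \<sigma> \<longleftrightarrow> chain s n" if "0 < n" for s n
  proof -
    have U: "\<Union> (set (take (Suc i) (map s [0..<n]))) = (\<Union>j\<le>i. s j)" if "Suc i < n" for i
      using that by (simp add: take_map take_upt atLeast0LessThan lessThan_Suc_atMost del: upt_Suc)
    have ne: "finite (s i) \<Longrightarrow> card (s i) \<in> range m \<Longrightarrow> s i \<noteq> {}" for i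
      using m_pos by (metis card.empty imageE less_irrefl)
    have head: "s 0 \<in> schreier \<longleftrightarrow> (\<forall>x\<in>s 0. card (s 0) \<le> Suc x)"
      if "finite (s 0)" "s 0 \<noteq> {}"
      using that Min_in[OF that] Min_le[OF that(1)] unfolding schreier_def
      by (simp, meson Suc_le_mono order_trans)
    have step: "Max (s i) < Min (s (Suc i)) \<longleftrightarrow> (\<forall>x\<in>s i. \<forall>y\<in>s (Suc i). x < y)"
      if "finite (s i)" "s i \<noteq> {}" "finite (s (Suc i))" "s (Suc i) \<noteq> {}" for i
      using that by (simp, blast)
    have card: "card (s i) < \<sigma> (\<Union>j\<le>i. s j)" if "\<And>j. j \<le> i \<Longrightarrow> finite (s j)" for i
    proof -
      have "card (s i) \<le> card (\<Union>j\<le>i. s j)" using that by (intro card_mono) auto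
      also have "\<dots> < \<sigma> (\<Union>j\<le>i. s j)" using that by (intro \<sigma>_card) auto
      finally show ?thesis .
    qed
    show ?thesis
    proof (cases "\<forall>i<n. finite (s i) \<and> card (s i) \<in> range m")
      case False
      then show ?thesis by (auto simp: B0_def chain_def)
    next
      case True
      define L where "L = map s [0..<n]"
      have L: "L \<noteq> []" "length L = n" "hd L = s 0" "\<And>i. i < n \<Longrightarrow> L ! i = s i" "set L = s ` {..<n}"
        using that by (auto simp: L_def hd_map)
      have UL: "\<Union> (set (take (Suc i) L)) = (\<Union>j\<le>i. s j)" if "Suc i < n" for i
        unfolding L_def using that by (rule U)
      have "L \<in> B0 m \<sigma> \<longleftrightarrow> s 0 \<in> schreier \<and> (\<forall>i. Suc i < n \<longrightarrow> Max (s i) < Min (s (Suc i)) \<and>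
          card (s (Suc i)) = \<sigma> (\<Union>j\<le>i. s j) \<and> card (s i) < \<sigma> (\<Union>j\<le>i. s j))"
        using True by (simp add: B0_def L UL cong: imp_cong)
      also have "s 0 \<in> schreier \<longleftrightarrow> (\<forall>x\<in>s 0. card (s 0) \<le> Suc x)"
        using True that ne by (intro head) auto
      also have "(\<forall>i. Suc i < n \<longrightarrow> Max (s i) < Min (s (Suc i)) \<and>
          card (s (Suc i)) = \<sigma> (\<Union>j\<le>i. s j) \<and> card (s i) < \<sigma> (\<Union>j\<le>i. s j)) \<longleftrightarrow>
          (\<forall>i. Suc i < n \<longrightarrow> (\<forall>x\<in>s i. \<forall>y\<in>s (Suc i). x < y) \<and>
            card (s (Suc i)) = \<sigma> (\<Union>j\<le>i. s j))"
      proof (intro all_cong1 imp_cong refl)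
        fix i assume i: "Suc i < n"
        have "card (s i) < \<sigma> (\<Union>j\<le>i. s j)" using i True by (intro card) simp
        moreover have "Max (s i) < Min (s (Suc i)) \<longleftrightarrow> (\<forall>x\<in>s i. \<forall>y\<in>s (Suc i). x < y)"
          using i True ne by (intro step) simp_all
        ultimately show "(Max (s i) < Min (s (Suc i)) \<and>
          card (s (Suc i)) = \<sigma> (\<Union>j\<le>i. s j) \<and> card (s i) < \<sigma> (\<Union>j\<le>i. s j)) \<longleftrightarrow>
          ((\<forall>x\<in>s i. \<forall>y\<in>s (Suc i). x < y) \<and> card (s (Suc i)) = \<sigma> (\<Union>j\<le>i. s j))" by simp
      qed
      finally show ?thesis using that True by (simp add: chain_def L_def)
    qed
  qed
  have fn: "(\<lambda>a. \<Sum>i<length ss. (1 / sqrt (real (card (ss ! i)))) * (\<Sum>j\<in>ss ! i. a j))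
      = chain_fun ((!) ss) (length ss)" for ss
    by (simp add: chain_fun_def fun_eq_iff)
  show ?thesis
  proof (intro set_eqI iffI)
    fix \<phi> assume "\<phi> \<in> N0 m \<sigma>"
    then obtain ss where ss: "ss \<in> B0 m \<sigma>" "\<phi> = chain_fun ((!) ss) (length ss)"
      unfolding N0_def fn by blast
    have "ss \<noteq> []" using ss(1) by (simp add: B0_def)
    then have "chain ((!) ss) (length ss)"
      using B0_iff[of "length ss" "(!) ss"] ss(1) by (simp add: map_nth)
    with ss(2) show "\<phi> \<in> {chain_fun s n | s n. chain s n}" by blast
  next
    fix \<phi> assume "\<phi> \<in> {chain_fun s n | s n. chain s n}"
    then obtain s n where s: "chain s n" "\<phi> = chain_fun s n" by blast
    then have "map s [0..<n] \<in> B0 m \<sigma>" using B0_iff by (simp add: chain_def)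
    moreover have "\<phi> = (\<lambda>a. \<Sum>i<length (map s [0..<n]).
        (1 / sqrt (real (card (map s [0..<n] ! i)))) * (\<Sum>j\<in>map s [0..<n] ! i. a j))"
      unfolding s(2) chain_fun_def by (intro ext sum.cong) auto
    ultimately show "\<phi> \<in> N0 m \<sigma>" unfolding N0_def by (rule image_eqI[rotated])
  qed
qed

text \<open>
  A chain can always be continued far to the right, since only the cardinality of the next set is
  prescribed.
\<close>

lemma infinite_chain_exists:
  assumes "infinite R"
  obtains s where "\<And>n. 0 < n \<Longrightarrow> chain s n" "\<And>i. s i \<subseteq> R"
proof -
  have far: "\<exists>T\<subseteq>R. finite T \<and> card T = c \<and> (\<forall>x\<in>T. N \<le> x)" for c N
  proof -
    have "infinite (R - {..<N})" using assms by simp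
    from infinite_arbitrarily_large[OF this, of c]
    obtain T where "finite T" "card T = c" "T \<subseteq> R - {..<N}" by blast
    then show ?thesis by (intro exI[of _ T]) auto
  qed
  \<comment> \<open>Starting beyond its own cardinality makes the first set a Schreier set.\<close>
  obtain T0 where T0: "T0 \<subseteq> R" "finite T0" "card T0 = m 0" "\<forall>x\<in>T0. m 0 \<le> x"
    using far by blast
  have "\<exists>T. T \<subseteq> R \<and> finite T \<and> card T = \<sigma> U \<and> (\<forall>x\<in>U. \<forall>y\<in>T. x < y)" if "finite U" for U
  proof -
    obtain N where "\<forall>x\<in>U. x < N" using \<open>finite U\<close> finite_nat_set_iff_bounded[of U] by blast
    moreover obtain T where "T \<subseteq> R" "finite T" "card T = \<sigma> U" "\<forall>y\<in>T. N \<le> y"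
      using far[of "\<sigma> U" N] by blast
    ultimately show ?thesis by (intro exI[of _ T]) (auto intro: less_le_trans)
  qed
  then obtain nxt where nxt: "\<And>U. finite U \<Longrightarrow> nxt U \<subseteq> R \<and> finite (nxt U) \<and>
      card (nxt U) = \<sigma> U \<and> (\<forall>x\<in>U. \<forall>y\<in>nxt U. x < y)"
    by metis
  define U where "U = rec_nat T0 (\<lambda>_ V. V \<union> nxt V)"
  define s where "s i = (case i of 0 \<Rightarrow> T0 | Suc k \<Rightarrow> nxt (U k))" for i
  have U: "U 0 = T0" "U (Suc k) = U k \<union> nxt (U k)" for k by (simp_all add: U_def)
  have s: "s 0 = T0" "s (Suc k) = nxt (U k)" for k by (simp_all add: s_def)
  have U_eq: "U i = (\<Union>j\<le>i. s j)" for i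
    by (induction i) (auto simp: U s atMost_Suc)
  have finU: "finite (U i)" for i
    by (induction i) (auto simp: U T0 nxt)
  have fs: "finite (s i) \<and> s i \<subseteq> R \<and> card (s i) \<in> range m" for i
  proof (cases i)
    case (Suc k)
    have "\<sigma> (U k) \<in> range m" using \<sigma>_range[OF finU] by blast
    then show ?thesis using nxt[OF finU, of k] by (simp add: Suc s)
  qed (use T0 in \<open>simp add: s\<close>)
  have "chain s n" if "0 < n" for n
    unfolding chain_def
  proof (intro conjI allI impI ballI)
    fix x y i assume xy: "x \<in> s i" "y \<in> s (Suc i)"
    then have "x \<in> U i" unfolding U_eq by blast
    then show "x < y" using xy nxt[OF finU, of i] by (simp add: s)
  next
    show "card (s (Suc i)) = \<sigma> (\<Union>j\<le>i. s j)" for i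
      using nxt[OF finU, of i] by (simp add: s U_eq)
  qed (use that fs T0 in \<open>auto simp: s le_SucI\<close>)
  then show ?thesis using that fs by blast
qed

definition rank :: "nat set \<Rightarrow> nat" where
  "rank u = inv m (card u)"

lemma m_rank: "chain s n \<Longrightarrow> i < n \<Longrightarrow> m (rank (s i)) = card (s i)"
  using chain_card_range by (simp add: rank_def f_inv_into_f)

lemma rank_inj: "chain s n \<Longrightarrow> inj_on (\<lambda>i. rank (s i)) {..<n}"
  unfolding inj_on_def
  by (metis chain_card_strict_mono lessThan_iff less_irrefl m_rank nat_neq_iff)

text \<open>
  A set of \<^term>\<open>m q\<close> elements meets the support in at most \<^term>\<open>min (m q) (m p)\<close> points, so it
  contributes at most \<^term>\<open>b * sqrt (m p) * ratio_term m q p\<close>; the indices \<^term>\<open>q\<close> are distinct.  The bound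
  shows that the supremum in the norm is over a bounded set and that flat vectors are small.
\<close>

lemma chain_fun_le:
  assumes s: "chain s n" and a: "finite (supp a)" "card (supp a) \<le> m p" "\<And>j. \<bar>a j\<bar> \<le> b"
  shows "\<bar>chain_fun s n a\<bar> \<le> 2 * b * sqrt (m p)"
proof -
  have b: "0 \<le> b" using a(3)[of 0] by simp
  have mp: "0 < real (m p)" using m_pos by simp
  have "\<bar>chain_fun s n a\<bar> \<le> (\<Sum>i<n. \<bar>(\<Sum>j\<in>s i. a j) / sqrt (card (s i))\<bar>)"
    unfolding chain_fun_def by (rule sum_abs)
  also have "\<dots> \<le> (\<Sum>i<n. b * sqrt (m p) * ratio_term m (rank (s i)) p)"
  proof (rule sum_mono)
    fix i assume "i \<in> {..<n}"
    then have i: "i < n" by simp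
    note fin = chain_finite[OF s i]
    define c where "c = real (card (s i))"
    have c: "c > 0" "c = m (rank (s i))" using chain_card_pos[OF s i] m_rank[OF s i] by (auto simp: c_def)
    have "\<bar>\<Sum>j\<in>s i. a j\<bar> = \<bar>\<Sum>j\<in>s i \<inter> supp a. a j\<bar>"
      using fin by (intro arg_cong[of _ _ abs] sum.mono_neutral_right) (auto simp: supp_def)
    also have "\<dots> \<le> (\<Sum>j\<in>s i \<inter> supp a. b)"
      by (intro order_trans[OF sum_abs] sum_mono a)
    also have "\<dots> = b * card (s i \<inter> supp a)" by simp
    also have "\<dots> \<le> b * min c (m p)"
    proof (intro mult_left_mono b)
      have "card (s i \<inter> supp a) \<le> card (s i)" "card (s i \<inter> supp a) \<le> card (supp a)"
        using fin a(1) by (auto intro: card_mono)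
      then show "real (card (s i \<inter> supp a)) \<le> min c (m p)" using a(2) by (simp add: c_def)
    qed
    finally have "\<bar>\<Sum>j\<in>s i. a j\<bar> \<le> b * min c (m p)" .
    then have "\<bar>(\<Sum>j\<in>s i. a j) / sqrt c\<bar> \<le> b * min c (m p) / sqrt c"
      using c(1) by (simp add: abs_divide divide_right_mono)
    also have "\<dots> = b * sqrt (m p) * (min c (m p) / sqrt (c * m p))"
      using c(1) mp by (simp add: real_sqrt_mult)
    also have "min c (m p) / sqrt (c * m p) = ratio_term m (rank (s i)) p"
      by (simp add: ratio_term_eq c(2))
    finally show "\<bar>(\<Sum>j\<in>s i. a j) / sqrt (card (s i))\<bar> \<le> b * sqrt (m p) * ratio_term m (rank (s i)) p"
      by (simp add: c_def)
  qed
  also have "\<dots> = b * sqrt (m p) * (\<Sum>i<n. ratio_term m (rank (s i)) p)"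
    by (simp add: sum_distrib_left)
  also have "\<dots> \<le> b * sqrt (m p) * 2"
    using rank_inj[OF s] b by (intro mult_left_mono sum_ratio_term_column_le) auto
  finally show ?thesis by (simp add: mult_ac)
qed

section \<open>Elementary properties of the Maurey--Rosenthal norm\<close>

abbreviation "MR \<equiv> MR_norm m \<sigma>"

lemma abs_bounded_c00:
  fixes a :: "nat \<Rightarrow> real"
  assumes "a \<in> c00"
  obtains b where "\<And>j. \<bar>a j\<bar> \<le> b"
proof
  fix j
  have "finite (supp a)" using assms by (simp add: c00_def)
  then show "\<bar>a j\<bar> \<le> (\<Sum>i\<in>supp a. \<bar>a i\<bar>)"
    by (cases "j \<in> supp a") (auto simp: supp_def sum_nonneg intro: member_le_sum)
qed

lemma chain_fun_le_MR:
  assumes "a \<in> c00" "chain s n"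
  shows "\<bar>chain_fun s n a\<bar> \<le> MR a"
proof -
  obtain b where b: "\<And>j. \<bar>a j\<bar> \<le> b" using abs_bounded_c00 assms by blast
  have "bdd_above ((\<lambda>\<phi>. \<bar>\<phi> a\<bar>) ` N0 m \<sigma>)"
    using chain_fun_le[of _ _ a "card (supp a)" b] b le_m assms
    by (intro bdd_aboveI2[of _ _ "2 * b * sqrt (m (card (supp a)))"]) (auto simp: N0_eq c00_def)
  moreover have "chain_fun s n \<in> N0 m \<sigma>" using assms by (auto simp: N0_eq)
  ultimately have "\<bar>chain_fun s n a\<bar> \<le> (SUP \<phi>\<in>N0 m \<sigma>. \<bar>\<phi> a\<bar>)"
    by (intro cSUP_upper)
  then show ?thesis by (simp add: MR_norm_def)
qed

lemma abs_le_MR: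
  assumes "a \<in> c00"
  shows "\<bar>a j\<bar> \<le> MR a"
proof -
  obtain b where b: "\<And>j. \<bar>a j\<bar> \<le> b" using abs_bounded_c00 assms by blast
  have "\<bar>a j\<bar> \<le> (SUP j. \<bar>a j\<bar>)"
    using b by (intro cSUP_upper bdd_aboveI2) auto
  then show ?thesis by (simp add: MR_norm_def)
qed

lemma MR_leI:
  assumes "\<And>s n. chain s n \<Longrightarrow> \<bar>chain_fun s n a\<bar> \<le> b" "\<And>j. \<bar>a j\<bar> \<le> b"
  shows "MR a \<le> b"
proof -
  obtain s where "chain s 1" using infinite_chain_exists[of UNIV] by auto
  then have "N0 m \<sigma> \<noteq> {}" by (auto simp: N0_eq)
  then show ?thesis
    unfolding MR_norm_def using assms by (intro max.boundedI cSUP_least) (auto simp: N0_eq)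
qed

lemma MR_nonneg: "a \<in> c00 \<Longrightarrow> 0 \<le> MR a"
  using abs_le_MR[of a 0] by (simp add: order_trans[OF abs_ge_zero])

text \<open>
  The first set of a chain that leaves \<^term>\<open>{..<N}\<close> can be replaced by its part below \<^term>\<open>N\<close>,
  filled up to its original cardinality with points beyond the support of \<^term>\<open>a\<close>.  The cardinality
  and the preceding sets being unchanged, this ends a chain, and the new chain acts on \<^term>\<open>a\<close>
  as the old one acts on the restriction of \<^term>\<open>a\<close>.
\<close>

lemma chain_fun_cut:
  assumes s: "chain s n" and a: "a \<in> c00"
  obtains t k where "chain t k" "chain_fun s n (\<lambda>i. if i < N then a i else 0) = chain_fun t k a"
proof (cases "\<forall>i<n. s i \<subseteq> {..<N}")
  case True
  have "chain_fun s n (\<lambda>i. if i < N then a i else 0) = chain_fun s n a"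
    unfolding chain_fun_def
    by (intro sum.cong arg_cong2[of _ _ _ _ "(/)"]) (use True in auto)
  then show ?thesis using that s by blast
next
  case False
  define k where "k = (LEAST i. i < n \<and> \<not> s i \<subseteq> {..<N})"
  have k: "k < n" "\<not> s k \<subseteq> {..<N}"
    using False LeastI_ex[of "\<lambda>i. i < n \<and> \<not> s i \<subseteq> {..<N}"] by (auto simp: k_def)
  have before: "s i \<subseteq> {..<N}" if "i < k" for i
    using not_less_Least[OF that[unfolded k_def]] that k by auto
  obtain z where z: "z \<in> s k" "N \<le> z" using k(2) by (meson lessThan_iff not_less subsetI)
  have after: "N \<le> y" if "k < i" "i < n" "y \<in> s i" for i y
    using chain_less[OF s that(1,2) z(1) that(3)] z(2) by simp
  define old where "old = s k \<inter> {..<N}"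
  have old: "finite old" "old \<subseteq> s k" "card old \<le> card (s k)"
    using chain_finite[OF s k(1)] by (auto simp: old_def intro: card_mono)
  obtain L where L: "\<forall>i\<in>supp a. i < L" using a finite_nat_set_iff_bounded[of "supp a"] unfolding c00_def by blast
  define start where "start = max (max N L) (card (s k))"
  define new where "new = {start..<start + (card (s k) - card old)}"
  define t where "t = s(k := old \<union> new)"
  have disj: "old \<inter> new = {}" by (auto simp: old_def new_def start_def)
  have tk: "t k = old \<union> new" by (simp add: t_def)
  have ti: "t i = s i" if "i \<noteq> k" for i
    using that by (simp add: t_def)
  have card_tk: "card (t k) = card (s k)" unfolding tk
    using disj old by (subst card_Un_disjoint) (auto simp: new_def)
  have new_ge: "N \<le> y" "card (s k) \<le> y" "y \<notin> supp a" if "y \<in> new" for y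
    using that L by (auto simp: new_def start_def)
  have "chain t (Suc k)"
    unfolding chain_def
  proof (intro conjI allI impI ballI)
    fix i assume "i < Suc k"
    then show "finite (t i)" "card (t i) \<in> range m"
      using chain_finite[OF s, of i] chain_card_range[OF s, of i] k old card_tk
      by (cases "i = k"; simp add: tk ti new_def)+
  next
    fix x assume x: "x \<in> t 0"
    show "card (t 0) \<le> Suc x"
    proof (cases "k = 0")
      case True
      then show ?thesis using x tk card_tk old(2) new_ge(2)[of x] chain_head[OF s, of x] by auto
    next
      case False
      then show ?thesis using x ti[of 0] chain_head[OF s] by simp
    qed
  next
    fix i x y assume i: "Suc i < Suc k" and x: "x \<in> t i" and y: "y \<in> t (Suc i)"
    have x': "x \<in> s i" "x < N" using i x before[of i] by (auto simp: ti)
    show "x < y"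
    proof (cases "y \<in> s (Suc i)")
      case True
      then show ?thesis using chain_step[OF s _ x'(1)] i k by simp
    next
      case False
      then have "y \<in> new" using y old(2) by (cases "Suc i = k") (auto simp: tk ti)
      then show ?thesis using x' new_ge(1) by force
    qed
  next
    fix i assume i: "Suc i < Suc k"
    have "(\<Union>j\<le>i. t j) = (\<Union>j\<le>i. s j)" using i by (intro SUP_cong) (auto simp: ti)
    moreover have "card (t (Suc i)) = card (s (Suc i))"
      using card_tk ti by (cases "Suc i = k") auto
    ultimately show "card (t (Suc i)) = \<sigma> (\<Union>j\<le>i. t j)"
      using chain_card_Suc[OF s, of i] i k by simp
  qed simp
  moreover have "chain_fun s n (\<lambda>i. if i < N then a i else 0) = chain_fun t (Suc k) a"
  proof -
    let ?c = "\<lambda>i. if i < N then a i else 0"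
    have "chain_fun s n ?c = (\<Sum>i<Suc k. (\<Sum>j\<in>s i. ?c j) / sqrt (card (s i)))"
      unfolding chain_fun_def
    proof (rule sum.mono_neutral_right)
      show "\<forall>i\<in>{..<n} - {..<Suc k}. (\<Sum>j\<in>s i. ?c j) / sqrt (card (s i)) = 0"
      proof
        fix i assume "i \<in> {..<n} - {..<Suc k}"
        then have "\<not> j < N" if "j \<in> s i" for j using after[of i j] that by (simp add: not_less)
        then have "(\<Sum>j\<in>s i. ?c j) = 0" by (intro sum.neutral) simp
        then show "(\<Sum>j\<in>s i. ?c j) / sqrt (card (s i)) = 0" by simp
      qed
    qed (use k in auto)
    also have "\<dots> = chain_fun t (Suc k) a"
      unfolding chain_fun_def
    proof (intro sum.cong refl)
      fix i assume "i \<in> {..<Suc k}"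
      then consider "i < k" | "i = k" by fastforce
      then show "(\<Sum>j\<in>s i. ?c j) / sqrt (card (s i)) = (\<Sum>j\<in>t i. a j) / sqrt (card (t i))"
      proof cases
        case 1
        then have "(\<Sum>j\<in>s i. ?c j) = (\<Sum>j\<in>s i. a j)"
          using before by (intro sum.cong) auto
        then show ?thesis using 1 by (simp add: ti)
      next
        case 2
        have "(\<Sum>j\<in>s k. ?c j) = (\<Sum>j\<in>old. a j)"
          using chain_finite[OF s k(1)] by (intro sum.mono_neutral_cong_right) (auto simp: old_def)
        also have "\<dots> = (\<Sum>j\<in>t k. a j)"
          unfolding tk using new_ge(3) old by (intro sum.mono_neutral_left) (auto simp: supp_def new_def)
        finally show ?thesis using 2 card_tk by simp
      qed
    qed
    finally show ?thesis .
  qed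
  ultimately show ?thesis using that by blast
qed

lemma supp_cut: "supp (\<lambda>i. if i < N then a i else 0) = supp a \<inter> {..<N}"
  by (auto simp: supp_def)

lemma MR_cut_le:
  assumes "a \<in> c00"
  shows "MR (\<lambda>i. if i < N then a i else 0) \<le> MR a"
proof (rule MR_leI)
  fix s n assume "chain s n"
  then show "\<bar>chain_fun s n (\<lambda>i. if i < N then a i else 0)\<bar> \<le> MR a"
    using chain_fun_cut[OF _ assms] chain_fun_le_MR[OF assms] by metis
qed (use abs_le_MR[OF assms] MR_nonneg[OF assms] in auto)

section \<open>Chains are determined by the cardinality of a later set\<close>

text \<open>
  The last set of a chain has more elements than all preceding ones together.  As the members
  of \<^term>\<open>m\<close> at least double, its cardinality can be read off from that of the union.
\<close>

lemma chain_Union_Suc_card_less: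
  assumes s: "chain s n" and i: "i < n"
  shows "card (\<Union>j\<le>i. s j) < 2 * card (s i)"
proof (cases i)
  case 0
  then show ?thesis using chain_card_pos[OF s i] by simp
next
  case (Suc k)
  have "(\<Union>j\<le>i. s j) = (\<Union>j\<le>k. s j) \<union> s i" by (auto simp: Suc atMost_Suc)
  then have "card (\<Union>j\<le>i. s j) \<le> card (\<Union>j\<le>k. s j) + card (s i)"
    by (simp add: card_Un_le)
  also have "\<dots> < 2 * card (s i)"
    using chain_card_Union_less[OF s, of k] i Suc by simp
  finally show ?thesis .
qed

text \<open>
  The last set is the final segment of the union with the cardinality determined by the union.
\<close>

lemma chain_last_eq:
  assumes s: "chain s n" "a < n" and t: "chain t n'" "i < n'"
    and U: "(\<Union>j\<le>i. t j) = (\<Union>j\<le>a. s j)"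
  shows "t i = s a"
proof -
  have no_gap: False
    if "chain v k" "b < k" "chain w l" "c < l" "(\<Union>j\<le>b. v j) = (\<Union>j\<le>c. w j)" "card (v b) < card (w c)"
    for v w k l b c
  proof -
    have "m (rank (v b)) < m (rank (w c))" using that by (simp add: m_rank)
    then have "rank (v b) < rank (w c)" using m_mono by (simp add: strict_mono_less)
    from m_double[OF this] have "2 * card (v b) \<le> card (w c)" using that by (simp add: m_rank)
    also have "card (w c) \<le> card (\<Union>j\<le>c. w j)"
      using that by (intro card_mono chain_finite_Union UN_upper) auto
    also have "\<dots> < 2 * card (v b)" using that chain_Union_Suc_card_less by metis
    finally show False by simp
  qed
  have card_eq: "card (t i) = card (s a)"
    using no_gap[OF s t] no_gap[OF t s] U by (metis nat_neq_iff)
  have final: "x < y" if "chain w l" "c < l" "x \<in> (\<Union>j\<le>c. w j)" "x \<notin> w c" "y \<in> w c" for w l c x y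
    using that chain_less[OF that(1)] by (metis UN_E atMost_iff le_neq_implies_less)
  have "t i \<subseteq> s a \<or> s a \<subseteq> t i"
  proof (rule ccontr)
    assume "\<not> (t i \<subseteq> s a \<or> s a \<subseteq> t i)"
    then obtain x y where xy: "x \<in> t i" "x \<notin> s a" "y \<in> s a" "y \<notin> t i" by blast
    have x: "x \<in> (\<Union>j\<le>i. t j)" by (intro UN_I[of i]) (use xy(1) in simp_all)
    have y: "y \<in> (\<Union>j\<le>a. s j)" by (intro UN_I[of a]) (use xy(3) in simp_all)
    have "x < y" by (rule final[OF s x[unfolded U] xy(2,3)])
    moreover have "y < x" by (rule final[OF t y[folded U] xy(4,1)])
    ultimately show False by simp
  qed
  then show ?thesis
    using card_eq chain_finite s t by (metis card_subset_eq)
qed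

text \<open>
  Equal cardinalities are equal codes, hence the unions of the preceding sets coincide.  Peeling off
  the last sets one by one shows that the two chains agree before this point.
\<close>

lemma chain_decode:
  assumes s: "chain s n" and t: "chain t n'"
  shows "0 < i \<Longrightarrow> i < n' \<Longrightarrow> 0 < a \<Longrightarrow> a < n \<Longrightarrow> card (t i) = card (s a) \<Longrightarrow>
    i = a \<and> (\<forall>b<i. t b = s b)"
proof (induction i arbitrary: a)
  case (Suc i)
  obtain a' where a': "a = Suc a'" using Suc.prems(3) by (cases a) auto
  have ia: "i < n'" "a' < n" using Suc.prems a' by auto
  have "\<sigma> (\<Union>j\<le>i. t j) = \<sigma> (\<Union>j\<le>a'. s j)"
    using Suc.prems a' chain_card_Suc[OF s, of a'] chain_card_Suc[OF t, of i] by simp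
  then have U: "(\<Union>j\<le>i. t j) = (\<Union>j\<le>a'. s j)"
    by (rule inj_onD[OF \<sigma>_inj]) (simp_all only: mem_Collect_eq chain_finite_Union[OF s ia(2)] chain_finite_Union[OF t ia(1)])
  have last: "t i = s a'" by (rule chain_last_eq[OF s ia(2) t ia(1) U])
  \<comment> \<open>If one chain is exhausted, so is the other, as no earlier set can fit into the last one.\<close>
  have first: "b = 0" if bk: "chain v k" "chain w l" "b < k" "v b = w 0" "(\<Union>j\<le>b. v j) = (\<Union>j\<le>0. w j)" for v w k l b
  proof (rule ccontr)
    assume "b \<noteq> 0"
    obtain x where x: "x \<in> v 0" using chain_nonempty[OF bk(1), of 0] bk(3) by auto
    have "x \<in> (\<Union>j\<le>b. v j)" using x by blast
    then have "x \<in> v b" using bk by simp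
    then show False using chain_disjoint[OF bk(1), of 0 b x] x \<open>b \<noteq> 0\<close> bk(3) by auto
  qed
  have "i = a' \<and> (\<forall>b<i. t b = s b)"
  proof (cases "i = 0")
    case True
    have "a' = 0" by (rule first[OF s t ia(2)]) (use True last U in simp_all)
    then show ?thesis using True by simp
  next
    case False
    have "0 < a'"
    proof (rule ccontr)
      assume "\<not> 0 < a'"
      then have "i = 0" by (intro first[OF t s ia(1)]) (use last U in simp_all)
      with False show False by simp
    qed
    then show ?thesis using Suc.IH[of a'] ia last False by simp
  qed
  then show ?case using a' last by (auto simp: less_Suc_eq)
qed simp

section \<open>Elementary properties of the RUC norm\<close>

abbreviation "RN \<equiv> RUC_norm m \<sigma>"

lemma c00I: "finite A \<Longrightarrow> (\<And>k. k \<notin> A \<Longrightarrow> a k = 0) \<Longrightarrow> a \<in> c00"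
  using finite_subset[of "{i. a i \<noteq> 0}" A] by (auto simp: c00_def supp_def)

lemma c00_mult: "a \<in> c00 \<Longrightarrow> (\<lambda>i. \<epsilon> i * a i) \<in> c00"
  using finite_subset[of "{i. \<epsilon> i * a i \<noteq> 0}" "{i. a i \<noteq> 0}"] by (auto simp: c00_def supp_def)

lemma c00_cut: "(\<lambda>i. if i < N then a i else 0) \<in> c00"
  by (rule c00I[of "{..<N}"]) auto

lemma MR_signs_cong:
  assumes "\<forall>i\<in>supp a. \<epsilon> i = \<epsilon>' i"
  shows "MR (\<lambda>i. \<epsilon> i * a i) = MR (\<lambda>i. \<epsilon>' i * a i)"
  using assms by (intro arg_cong[of _ _ MR]) (auto simp: supp_def fun_eq_iff)

lemma RUC_norm_superset:
  assumes "finite A" "supp a \<subseteq> A"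
  shows "RN a = MR a + sign_avg A (\<lambda>\<epsilon>. MR (\<lambda>i. \<epsilon> i * a i))"
  unfolding RUC_norm_def
  by (subst sign_avg_superset[OF assms]) (auto intro: MR_signs_cong)

lemma MR_le_RUC_norm:
  assumes "a \<in> c00"
  shows "MR a \<le> RN a"
proof -
  have "0 = sign_avg (supp a) (\<lambda>_. 0)" by (simp add: sign_avg_def)
  also have "\<dots> \<le> sign_avg (supp a) (\<lambda>\<epsilon>. MR (\<lambda>i. \<epsilon> i * a i))"
    by (intro sign_avg_mono MR_nonneg c00_mult assms)
  finally show ?thesis by (simp add: RUC_norm_def)
qed

lemma RUC_norm_cut_le:
  assumes "a \<in> c00"
  shows "RN (\<lambda>i. if i < N then a i else 0) \<le> RN a"
proof -
  let ?c = "\<lambda>i. if i < N then a i else 0"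
  have "RN ?c = MR ?c + sign_avg (supp a) (\<lambda>\<epsilon>. MR (\<lambda>i. \<epsilon> i * ?c i))"
    using assms by (intro RUC_norm_superset) (auto simp: supp_cut c00_def)
  also have "\<dots> \<le> MR a + sign_avg (supp a) (\<lambda>\<epsilon>. MR (\<lambda>i. \<epsilon> i * a i))"
  proof (intro add_mono MR_cut_le assms sign_avg_mono)
    fix \<epsilon> :: "nat \<Rightarrow> real"
    have "(\<lambda>i. \<epsilon> i * ?c i) = (\<lambda>i. if i < N then \<epsilon> i * a i else 0)" by auto
    then show "MR (\<lambda>i. \<epsilon> i * ?c i) \<le> MR (\<lambda>i. \<epsilon> i * a i)"
      using MR_cut_le[OF c00_mult[OF assms]] by simp
  qed
  finally show ?thesis by (simp add: RUC_norm_def)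
qed

text \<open>
  Changing signs leaves the average in the definition of the norm unchanged, and averaging the
  Maurey--Rosenthal part reproduces that average.
\<close>

lemma sign_avg_RUC_norm_le:
  assumes "finite A" "supp a \<subseteq> A"
  shows "sign_avg A (\<lambda>\<epsilon>. RN (\<lambda>i. \<epsilon> i * a i)) \<le> 2 * RN a"
proof -
  let ?E = "sign_avg A (\<lambda>\<eta>. MR (\<lambda>i. \<eta> i * a i))"
  have a: "a \<in> c00" using assms finite_subset by (auto simp: c00_def)
  have "sign_avg A (\<lambda>\<epsilon>. RN (\<lambda>i. \<epsilon> i * a i)) = sign_avg A (\<lambda>\<epsilon>. MR (\<lambda>i. \<epsilon> i * a i) + ?E)"
  proof (rule sign_avg_cong)
    fix \<epsilon> :: "nat \<Rightarrow> real" assume \<epsilon>: "\<epsilon> \<in> A \<rightarrow>\<^sub>E {-1, 1}"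
    have "RN (\<lambda>i. \<epsilon> i * a i)
        = MR (\<lambda>i. \<epsilon> i * a i) + sign_avg A (\<lambda>\<eta>. MR (\<lambda>i. \<eta> i * (\<epsilon> i * a i)))"
      using assms by (intro RUC_norm_superset) (auto simp: supp_def)
    also have "sign_avg A (\<lambda>\<eta>. MR (\<lambda>i. \<eta> i * (\<epsilon> i * a i)))
        = sign_avg A (\<lambda>\<eta>. MR (\<lambda>i. (\<eta> i * \<epsilon> i) * a i))"
      by (simp add: mult.assoc)
    also have "\<dots> = ?E"
      using assms \<epsilon>
      by (intro sign_avg_sign_change[where F = "\<lambda>\<eta>. MR (\<lambda>i. \<eta> i * a i)"] MR_signs_cong)
        (auto dest: PiE_mem)
    finally show "RN (\<lambda>i. \<epsilon> i * a i) = MR (\<lambda>i. \<epsilon> i * a i) + ?E" .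
  qed
  also have "\<dots> = 2 * ?E" using assms by (simp add: sign_avg_add sign_avg_const)
  also have "\<dots> \<le> 2 * RN a"
    using RUC_norm_superset[OF assms] MR_nonneg[OF a] by simp
  finally show ?thesis .
qed

lemma RUC_norm_flat_le:
  assumes A: "finite A" "card A = m p" and \<eta>: "\<And>i. \<bar>\<eta> i\<bar> \<le> 1"
  shows "RN (\<lambda>i. if i \<in> A then \<eta> i else 0) \<le> 4 * sqrt (m p)"
proof -
  have MR_le: "MR a \<le> 2 * sqrt (m p)" if "supp a \<subseteq> A" "\<And>i. \<bar>a i\<bar> \<le> 1" for a
  proof (rule MR_leI)
    have s: "finite (supp a)" "card (supp a) \<le> m p"
      using that(1) A finite_subset card_mono by metis+
    show "\<bar>chain_fun s n a\<bar> \<le> 2 * sqrt (m p)" if "chain s n" for s n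
      using chain_fun_le[OF that s \<open>\<And>i. \<bar>a i\<bar> \<le> 1\<close>] by simp
    have "1 \<le> sqrt (m p)" using m_pos[of p] by simp
    then show "\<bar>a j\<bar> \<le> 2 * sqrt (m p)" for j using that(2)[of j] by linarith
  qed
  let ?a = "\<lambda>i. if i \<in> A then \<eta> i else 0"
  have supp: "supp ?a \<subseteq> A" by (auto simp: supp_def)
  have "RN ?a = MR ?a + sign_avg A (\<lambda>\<epsilon>. MR (\<lambda>i. \<epsilon> i * ?a i))"
    by (intro RUC_norm_superset A supp)
  also have "\<dots> \<le> 2 * sqrt (m p) + sign_avg A (\<lambda>\<epsilon>. 2 * sqrt (m p))"
  proof (intro add_mono MR_le sign_avg_mono supp)
    fix \<epsilon> :: "nat \<Rightarrow> real" assume \<epsilon>: "\<epsilon> \<in> A \<rightarrow>\<^sub>E {-1, 1}"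
    show "supp (\<lambda>i. \<epsilon> i * ?a i) \<subseteq> A" by (auto simp: supp_def)
    show "\<bar>\<epsilon> i * ?a i\<bar> \<le> 1" for i
      using \<eta>[of i] PiE_mem[OF \<epsilon>, of i] by (auto simp: abs_mult)
  qed (use \<eta> in auto)
  also have "\<dots> = 4 * sqrt (m p)" using A by (simp add: sign_avg_const)
  finally show ?thesis .
qed

section \<open>Blocks along a chain\<close>

text \<open>
  The combination with coefficients \<^term>\<open>c\<close> of the normalised indicator functions of the first
  \<^term>\<open>n\<close> sets.
\<close>

definition block :: "(nat \<Rightarrow> nat set) \<Rightarrow> (nat \<Rightarrow> real) \<Rightarrow> nat \<Rightarrow> nat \<Rightarrow> real" where
  "block s c n k = (\<Sum>a<n. if k \<in> s a then c a / sqrt (card (s a)) else 0)"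

lemma block_eq:
  assumes "chain s n" "a < n" "k \<in> s a"
  shows "block s c n k = c a / sqrt (card (s a))"
proof -
  have "block s c n k = (\<Sum>b<n. if b = a then c b / sqrt (card (s b)) else 0)"
    unfolding block_def using chain_disjoint[OF assms(1)] assms by (intro sum.cong) auto
  then show ?thesis using assms(2) by simp
qed

lemma block_outside: "k \<notin> (\<Union>a<n. s a) \<Longrightarrow> block s c n k = 0"
  by (auto simp: block_def intro!: sum.neutral)

lemma block_supp:
  shows "chain s n \<Longrightarrow> finite (\<Union>a<n. s a)" and "supp (block s c n) \<subseteq> (\<Union>a<n. s a)"
proof -
  show "chain s n \<Longrightarrow> finite (\<Union>a<n. s a)" by (auto intro: chain_finite)
  show "supp (block s c n) \<subseteq> (\<Union>a<n. s a)"
    using block_outside unfolding supp_def by blast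
qed

lemma block_c00: "chain s n \<Longrightarrow> block s c n \<in> c00"
  using finite_subset[OF block_supp(2) block_supp(1)] by (simp add: c00_def)

lemma abs_block_le:
  assumes s: "chain s n" and c: "\<And>a. a < n \<Longrightarrow> \<bar>c a\<bar> \<le> C"
  shows "\<bar>block s c n k\<bar> \<le> C"
proof (cases "k \<in> (\<Union>a<n. s a)")
  case True
  then obtain a where a: "a < n" "k \<in> s a" by blast
  have "1 \<le> sqrt (card (s a))" using chain_card_pos[OF s a(1)] by simp
  then have "\<bar>c a\<bar> / sqrt (card (s a)) \<le> \<bar>c a\<bar> / 1" by (intro divide_left_mono) auto
  then show ?thesis using c[OF a(1)] block_eq[OF s a] by (simp add: abs_divide)
next
  case False
  have "0 < n" using s by (simp add: chain_def)
  then show ?thesis using block_outside[OF False] c[of 0] by simp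
qed

lemma chain_fun_block:
  assumes s: "chain s n"
  shows "chain_fun s n (block s c n) = (\<Sum>a<n. c a)"
  unfolding chain_fun_def
proof (rule sum.cong)
  fix i assume "i \<in> {..<n}"
  then have i: "i < n" by simp
  have "(\<Sum>j\<in>s i. block s c n j) = card (s i) * (c i / sqrt (card (s i)))"
    using block_eq[OF s i] by simp
  then show "(\<Sum>j\<in>s i. block s c n j) / sqrt (card (s i)) = c i"
    using chain_card_pos[OF s i] by simp
qed simp

text \<open>
  Expand the functional over the pairs of a set of \<^term>\<open>t\<close> and a set of \<^term>\<open>s\<close>.  Pairs of different
  cardinalities contribute at most \<^term>\<open>C\<close> in total by lacunarity.  By the decoding, pairs of equal
  cardinality lie on the diagonal up to the last such pair, the two chains being equal
  before it; the exceptions are this last pair, where the sets may differ, and one pair each involving the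
  first set of \<^term>\<open>s\<close> or of \<^term>\<open>t\<close>, whose cardinality is not a code of its past.  Signs are
  allowed throughout because the estimates only use the cardinalities of the intersections.
\<close>

lemma chain_fun_block_le:
  assumes s: "chain s n" and t: "chain t n'"
    and c: "\<And>a. a < n \<Longrightarrow> \<bar>c a\<bar> \<le> C"
    and \<epsilon>: "\<And>k. k \<in> (\<Union>a<n. s a) \<Longrightarrow> \<bar>\<epsilon> k\<bar> \<le> 1"
  obtains l where "l \<le> n" "\<bar>chain_fun t n' (\<lambda>k. \<epsilon> k * block s c n k)\<bar>
    \<le> \<bar>\<Sum>b<l. c b * ((\<Sum>k\<in>s b. \<epsilon> k) / card (s b))\<bar> + 4 * C"
proof -
  have "0 < n" using s by (simp add: chain_def)
  then have C: "0 \<le> C" using c[of 0] by simp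
  define g where "g = (\<lambda>(i, a). c a * (\<Sum>k\<in>t i \<inter> s a. \<epsilon> k) / sqrt (real (card (t i)) * card (s a)))"
  define D where "D = {..<n'} \<times> {..<n}"
  define M where "M = {(i, a) \<in> D. card (t i) = card (s a)}"
  have fin: "finite D" "finite M" "M \<subseteq> D"
  proof -
    show D: "finite D" by (simp add: D_def)
    show "M \<subseteq> D" by (auto simp: M_def)
    then show "finite M" using D finite_subset by blast
  qed
  have expand: "chain_fun t n' (\<lambda>k. \<epsilon> k * block s c n k) = (\<Sum>p\<in>D. g p)"
  proof -
    have "(\<Sum>k\<in>t i. \<epsilon> k * block s c n k) / sqrt (card (t i)) = (\<Sum>a<n. g (i, a))" if i: "i < n'" for i
    proof -
      have "(\<Sum>k\<in>t i. \<epsilon> k * block s c n k)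
          = (\<Sum>a<n. \<Sum>k\<in>t i. if k \<in> s a then \<epsilon> k * (c a / sqrt (card (s a))) else 0)"
        unfolding block_def sum_distrib_left
        by (subst sum.swap) (intro sum.cong refl, simp)
      also have "\<dots> = (\<Sum>a<n. \<Sum>k\<in>t i \<inter> s a. \<epsilon> k * (c a / sqrt (card (s a))))"
        using chain_finite[OF t i] by (simp only: sum.inter_restrict)
      finally show ?thesis
        by (simp add: g_def sum_divide_distrib sum_distrib_left sum_distrib_right
            real_sqrt_mult mult_ac)
    qed
    then show ?thesis by (simp add: chain_fun_def D_def sum.cartesian_product')
  qed
  have g_le: "\<bar>g (i, a)\<bar> \<le> C * ratio_term m (rank (t i)) (rank (s a))" if "(i, a) \<in> D" for i a
  proof -
    have ia: "i < n'" "a < n" using that by (auto simp: D_def)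
    note f = chain_finite[OF t ia(1)] chain_finite[OF s ia(2)]
    let ?r = "sqrt (real (card (t i)) * card (s a))"
    have "\<bar>\<Sum>k\<in>t i \<inter> s a. \<epsilon> k\<bar> \<le> (\<Sum>k\<in>t i \<inter> s a. 1)"
      using ia by (intro order_trans[OF sum_abs] sum_mono \<epsilon>) auto
    also have "\<dots> \<le> min (real (card (t i))) (card (s a))"
      using f by (auto intro: card_mono)
    finally have "\<bar>c a\<bar> * \<bar>\<Sum>k\<in>t i \<inter> s a. \<epsilon> k\<bar> \<le> C * min (real (card (t i))) (card (s a))"
      using c[OF ia(2)] C by (intro mult_mono) auto
    then have "\<bar>c a\<bar> * \<bar>\<Sum>k\<in>t i \<inter> s a. \<epsilon> k\<bar> / ?r \<le> C * min (real (card (t i))) (card (s a)) / ?r"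
      by (intro divide_right_mono) auto
    then show ?thesis
      by (simp add: g_def abs_mult abs_divide ratio_term_eq m_rank[OF t ia(1)] m_rank[OF s ia(2)])
  qed
  have off: "\<bar>\<Sum>p\<in>D - M. g p\<bar> \<le> C"
  proof -
    let ?h = "\<lambda>(i, a). (rank (t i), rank (s a))"
    have inj: "inj_on ?h (D - M)"
      using rank_inj[OF s] rank_inj[OF t] by (auto simp: inj_on_def D_def)
    have "\<bar>\<Sum>p\<in>D - M. g p\<bar> \<le> (\<Sum>(i, a)\<in>D - M. C * ratio_term m (rank (t i)) (rank (s a)))"
      by (intro order_trans[OF sum_abs] sum_mono) (auto intro!: g_le)
    also have "\<dots> = C * (\<Sum>(j, k)\<in>?h ` (D - M). ratio_term m j k)"
      by (subst sum.reindex[OF inj]) (simp add: sum_distrib_left case_prod_beta)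
    also have "\<dots> \<le> C * \<delta>"
    proof (intro mult_left_mono C sum_ratio_term_le)
      fix j k assume "(j, k) \<in> ?h ` (D - M)"
      then obtain i a where ia: "(i, a) \<in> D - M" "j = rank (t i)" "k = rank (s a)" by auto
      then have "card (t i) \<noteq> card (s a)" "i < n'" "a < n" by (auto simp: D_def M_def)
      then show "j \<noteq> k" using m_rank[OF t] m_rank[OF s] ia by metis
    qed (use fin in auto)
    also have "\<dots> \<le> C * 1" using \<delta>_less C by (intro mult_left_mono) auto
    finally show ?thesis by simp
  qed
  have g_le': "\<bar>g p\<bar> \<le> C" if "p \<in> M" for p
  proof -
    obtain i a where p: "p = (i, a)" by (cases p)
    have "rank (t i) = rank (s a)" using that by (simp add: rank_def M_def p)
    then show ?thesis using g_le[of i a] that by (simp add: p ratio_term_same M_def)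
  qed
  \<comment> \<open>The pairs to which the decoding applies; the largest of them is the point where the chains part.\<close>
  define Q where "Q = {(i, a) \<in> M. 0 < i \<and> 0 < a}"
  define l where "l = (if Q = {} then 0 else Max (fst ` Q))"
  have fQ: "finite Q" by (rule finite_subset[OF _ fin(2)]) (auto simp: Q_def)
  have dec: "i = a \<and> (\<forall>b<i. t b = s b)" if "(i, a) \<in> Q" for i a
    using chain_decode[OF s t, of i a] that by (auto simp: Q_def M_def D_def)
  have Q_le: "i \<le> l" if "(i, a) \<in> Q" for i a
  proof -
    have "i \<in> fst ` Q" using that by (rule image_eqI[rotated]) simp
    then have "i \<le> Max (fst ` Q)" using fQ by (intro Max_ge) auto
    then show ?thesis using that by (auto simp: l_def)
  qed
  have l: "(l, l) \<in> Q" if "Q \<noteq> {}"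
  proof -
    have "l \<in> fst ` Q" unfolding l_def using that fQ by simp
    then obtain a where "(l, a) \<in> Q" by auto
    then show ?thesis using dec by blast
  qed
  have l_bound: "l \<le> n" "l \<le> n'" "\<And>b. b < l \<Longrightarrow> t b = s b"
  proof -
    show "l \<le> n" using l by (cases "Q = {}") (auto simp: l_def Q_def M_def D_def)
    show "l \<le> n'" using l by (cases "Q = {}") (auto simp: l_def Q_def M_def D_def)
    show "t b = s b" if "b < l" for b
      using that l dec[of l l] by (cases "Q = {}") (auto simp: l_def)
  qed
  define G where "G = (\<lambda>b. (b, b)) ` {..<l}"
  have GM: "G \<subseteq> M" using l_bound by (auto simp: G_def M_def D_def)
  have card_MG: "card (M - G) \<le> 3"
  proof -
    have sub: "M - G \<subseteq> {(l, l)} \<union> ({(i, a) \<in> M. a = 0} \<union> {(i, a) \<in> M. i = 0})"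
    proof
      fix p assume p: "p \<in> M - G"
      obtain i a where ia: "p = (i, a)" by (cases p)
      show "p \<in> {(l, l)} \<union> ({(i, a) \<in> M. a = 0} \<union> {(i, a) \<in> M. i = 0})"
      proof (cases "p \<in> Q")
        case True
        then have "i = a" "i \<le> l" using dec Q_le ia by blast+
        moreover have "\<not> i < l" using p ia \<open>i = a\<close> by (auto simp: G_def)
        ultimately show ?thesis using ia by simp
      next
        case False
        then show ?thesis using p ia by (auto simp: Q_def)
      qed
    qed
    have t_inj: "i = i'" if "i < n'" "i' < n'" "card (t i) = card (t i')" for i i'
      using chain_card_strict_mono[OF t] that by (metis less_irrefl nat_neq_iff)
    have s_inj: "i = i'" if "i < n" "i' < n" "card (s i) = card (s i')" for i i'
      using chain_card_strict_mono[OF s] that by (metis less_irrefl nat_neq_iff)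
    have "finite {(i, a) \<in> M. a = 0}" "finite {(i, a) \<in> M. i = 0}"
      using fin(2) by (auto elim!: finite_subset[rotated])
    then have "card {(i, a) \<in> M. a = 0} \<le> 1" "card {(i, a) \<in> M. i = 0} \<le> 1"
      by (auto simp: card_le_Suc0_iff_eq M_def D_def intro: t_inj s_inj)
    then have "card ({(l, l)} \<union> ({(i, a) \<in> M. a = 0} \<union> {(i, a) \<in> M. i = 0})) \<le> 1 + (1 + 1)"
      by (intro order_trans[OF card_Un_le] add_mono) auto
    moreover have "finite ({(l, l)} \<union> ({(i, a) \<in> M. a = 0} \<union> {(i, a) \<in> M. i = 0}))"
      using fin(2) by (auto elim!: finite_subset[rotated])
    ultimately show ?thesis using card_mono[OF _ sub] by linarith
  qed
  have rest: "\<bar>\<Sum>p\<in>M - G. g p\<bar> \<le> 3 * C"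
  proof -
    have "\<bar>\<Sum>p\<in>M - G. g p\<bar> \<le> (\<Sum>p\<in>M - G. C)"
      by (intro order_trans[OF sum_abs] sum_mono g_le') auto
    also have "\<dots> = card (M - G) * C" by simp
    also have "\<dots> \<le> 3 * C" using card_MG C by (intro mult_right_mono) auto
    finally show ?thesis .
  qed
  have diag: "(\<Sum>p\<in>G. g p) = (\<Sum>b<l. c b * ((\<Sum>k\<in>s b. \<epsilon> k) / card (s b)))"
    unfolding G_def by (subst sum.reindex) (auto simp: inj_on_def g_def l_bound(3))
  have "(\<Sum>p\<in>D. g p) = (\<Sum>p\<in>D - M. g p) + ((\<Sum>p\<in>M - G. g p) + (\<Sum>p\<in>G. g p))"
    using fin GM by (simp add: sum.subset_diff[symmetric])
  then have "\<bar>chain_fun t n' (\<lambda>k. \<epsilon> k * block s c n k)\<bar> \<le> \<bar>\<Sum>p\<in>G. g p\<bar> + 4 * C"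
    using off rest expand by linarith
  with that[OF l_bound(1)] show ?thesis by (simp only: diag)
qed

text \<open>
  Without signs the leading term is a partial sum of \<^term>\<open>c\<close>, and single coefficients are differences
  of two partial sums.
\<close>

lemma MR_block_le:
  assumes s: "chain s n" and c: "\<And>l. l \<le> n \<Longrightarrow> \<bar>\<Sum>a<l. c a\<bar> \<le> B"
  shows "MR (block s c n) \<le> 9 * B"
proof -
  have B: "0 \<le> B" using c[of 0] by simp
  have c': "\<bar>c a\<bar> \<le> 2 * B" if "a < n" for a
    using c[of a] c[of "Suc a"] that by simp
  show ?thesis
  proof (rule MR_leI)
    fix t n' assume t: "chain t n'"
    obtain l where l: "l \<le> n" "\<bar>chain_fun t n' (\<lambda>k. 1 * block s c n k)\<bar>
        \<le> \<bar>\<Sum>b<l. c b * ((\<Sum>k\<in>s b. 1) / card (s b))\<bar> + 4 * (2 * B)"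
      by (rule chain_fun_block_le[OF s t c', where \<epsilon> = "\<lambda>_. 1"]) auto
    have "(\<Sum>b<l. c b * ((\<Sum>k\<in>s b. 1) / card (s b))) = (\<Sum>b<l. c b)"
      using chain_nonempty[OF s] chain_finite[OF s] l(1) by (intro sum.cong) auto
    then show "\<bar>chain_fun t n' (block s c n)\<bar> \<le> 9 * B" using l c[OF l(1)] by simp
  next
    show "\<bar>block s c n k\<bar> \<le> 9 * B" for k
      using abs_block_le[OF s, where c = c and C = "2 * B" and k = k, OF c'] B by simp
  qed
qed

lemma sum_inverse_sqrt_card_le:
  assumes s: "chain s n"
  shows "(\<Sum>b<n. 1 / sqrt (card (s b))) \<le> 2"
proof -
  have "(\<Sum>b<n. 1 / sqrt (card (s b))) \<le> (\<Sum>b<n. ratio_term m (rank (s b)) 0)"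
  proof (rule sum_mono)
    fix b assume "b \<in> {..<n}"
    then have b: "b < n" by simp
    have m0: "real (m 0) \<ge> 1" using m_pos[of 0] by simp
    have "m 0 \<le> m (rank (s b))" using m_mono by (simp add: strict_mono_less_eq)
    then have le: "real (m 0) \<le> card (s b)" by (simp add: m_rank[OF s b])
    have "1 / sqrt (card (s b)) \<le> sqrt (m 0) / sqrt (card (s b))"
      using m0 by (intro divide_right_mono) auto
    also have "\<dots> = real (m 0) / sqrt (real (card (s b)) * m 0)"
      using m0 chain_card_pos[OF s b] by (simp add: real_sqrt_mult field_simps)
    also have "\<dots> = ratio_term m (rank (s b)) 0"
      using le by (simp add: ratio_term_eq m_rank[OF s b] min_def)
    finally show "1 / sqrt (card (s b)) \<le> ratio_term m (rank (s b)) 0" .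
  qed
  also have "\<dots> \<le> 2" by (rule sum_ratio_term_column_le) (use rank_inj[OF s] in auto)
  finally show ?thesis .
qed

text \<open>
  The leading term is bounded, uniformly in the functional, by the sum of the averages of the signs over
  the sets of the chain, and the expectations of these averages are summable.
\<close>

lemma sign_avg_MR_block_le:
  assumes s: "chain s n" and c: "\<And>a. a < n \<Longrightarrow> \<bar>c a\<bar> \<le> C"
  shows "sign_avg (\<Union>a<n. s a) (\<lambda>\<epsilon>. MR (\<lambda>k. \<epsilon> k * block s c n k)) \<le> 6 * C"
proof -
  let ?A = "\<Union>a<n. s a"
  have "0 < n" using s by (simp add: chain_def)
  then have C: "0 \<le> C" using c[of 0] by simp
  have fA: "finite ?A" by (rule block_supp(1)[OF s])
  let ?mean = "\<lambda>b (\<epsilon>::nat \<Rightarrow> real). \<bar>\<Sum>k\<in>s b. \<epsilon> k\<bar> / card (s b)"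
  have "sign_avg ?A (\<lambda>\<epsilon>. MR (\<lambda>k. \<epsilon> k * block s c n k))
      \<le> sign_avg ?A (\<lambda>\<epsilon>. C * (\<Sum>b<n. ?mean b \<epsilon>) + 4 * C)"
  proof (rule sign_avg_mono)
    fix \<epsilon> :: "nat \<Rightarrow> real" assume signs: "\<epsilon> \<in> ?A \<rightarrow>\<^sub>E {-1, 1}"
    have \<epsilon>: "\<bar>\<epsilon> k\<bar> \<le> 1" if "k \<in> ?A" for k
    proof -
      have "\<epsilon> k \<in> {-1, 1}" by (rule PiE_mem[OF signs that])
      then show ?thesis by auto
    qed
    have nonneg: "0 \<le> C * (\<Sum>b<n. ?mean b \<epsilon>)"
      using C by (intro mult_nonneg_nonneg sum_nonneg) auto
    show "MR (\<lambda>k. \<epsilon> k * block s c n k) \<le> C * (\<Sum>b<n. ?mean b \<epsilon>) + 4 * C"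
    proof (rule MR_leI)
      fix t n' assume t: "chain t n'"
      obtain l where l: "l \<le> n" "\<bar>chain_fun t n' (\<lambda>k. \<epsilon> k * block s c n k)\<bar>
          \<le> \<bar>\<Sum>b<l. c b * ((\<Sum>k\<in>s b. \<epsilon> k) / card (s b))\<bar> + 4 * C"
        by (rule chain_fun_block_le[OF s t c \<epsilon>])
      have "\<bar>\<Sum>b<l. c b * ((\<Sum>k\<in>s b. \<epsilon> k) / card (s b))\<bar> \<le> (\<Sum>b<l. C * ?mean b \<epsilon>)"
      proof (intro order_trans[OF sum_abs] sum_mono)
        fix b assume "b \<in> {..<l}"
        then have "\<bar>c b\<bar> * ?mean b \<epsilon> \<le> C * ?mean b \<epsilon>"
          using l(1) by (intro mult_right_mono c) simp_all
        then show "\<bar>c b * ((\<Sum>k\<in>s b. \<epsilon> k) / card (s b))\<bar> \<le> C * ?mean b \<epsilon>"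
          unfolding abs_mult abs_divide by simp
      qed
      also have "\<dots> \<le> (\<Sum>b<n. C * ?mean b \<epsilon>)"
        using l(1) C by (intro sum_mono2) auto
      finally show "\<bar>chain_fun t n' (\<lambda>k. \<epsilon> k * block s c n k)\<bar> \<le> C * (\<Sum>b<n. ?mean b \<epsilon>) + 4 * C"
        using l(2) by (simp add: sum_distrib_left)
    next
      fix k
      have "\<bar>\<epsilon> k * block s c n k\<bar> \<le> C"
      proof (cases "k \<in> ?A")
        case True
        have "\<bar>\<epsilon> k\<bar> * \<bar>block s c n k\<bar> \<le> 1 * C"
          using \<epsilon>[OF True] abs_block_le[OF s c] by (intro mult_mono) auto
        then show ?thesis by (simp add: abs_mult)
      qed (use C in \<open>simp add: block_outside\<close>)
      then show "\<bar>\<epsilon> k * block s c n k\<bar> \<le> C * (\<Sum>b<n. ?mean b \<epsilon>) + 4 * C"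
        using nonneg C by linarith
    qed
  qed
  also have "\<dots> = C * (\<Sum>b<n. sign_avg ?A (?mean b)) + 4 * C"
    using fA by (simp only: sign_avg_add sign_avg_scale sign_avg_sum sign_avg_const)
  also have "(\<Sum>b<n. sign_avg ?A (?mean b)) \<le> (\<Sum>b<n. 1 / sqrt (card (s b)))"
  proof (rule sum_mono)
    fix b assume "b \<in> {..<n}"
    then have b: "b < n" by simp
    have "sign_avg ?A (?mean b) = sign_avg (s b) (?mean b)"
    proof (rule sign_avg_superset[OF fA])
      show "?mean b \<epsilon> = ?mean b \<epsilon>'" if "\<forall>i\<in>s b. \<epsilon> i = \<epsilon>' i" for \<epsilon> \<epsilon>'
        using that by simp
    qed (use b in blast)
    also have "\<dots> \<le> 1 / sqrt (card (s b))"
      by (rule sign_avg_abs_mean_le[OF chain_finite[OF s b] chain_nonempty[OF s b]])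
    finally show "sign_avg ?A (?mean b) \<le> 1 / sqrt (card (s b))" .
  qed
  also have "\<dots> \<le> 2" by (rule sum_inverse_sqrt_card_le[OF s])
  finally show ?thesis using C by (simp add: mult_left_mono)
qed

lemma RUC_norm_block_le:
  assumes s: "chain s n" and c: "\<And>l. l \<le> n \<Longrightarrow> \<bar>\<Sum>a<l. c a\<bar> \<le> B"
  shows "RN (block s c n) \<le> 21 * B"
proof -
  have c': "\<bar>c a\<bar> \<le> 2 * B" if "a < n" for a
    using c[of a] c[of "Suc a"] that by simp
  show ?thesis
    using MR_block_le[OF s c] sign_avg_MR_block_le[OF s, where c = c and C = "2 * B", OF c'] RUC_norm_superset[OF block_supp(1)[OF s] block_supp(2)[where c = c]]
    by simp
qed

end

section \<open>The completion and its unit vectors\<close>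

locale RUC_completion = Maurey_Rosenthal +
  fixes J :: "(nat \<Rightarrow> real) \<Rightarrow> 'a::banach" and Z :: "'a set"
  assumes completion: "is_completion (RUC_norm m \<sigma>) J Z"
begin

abbreviation e :: "nat \<Rightarrow> 'a" where
  "e n \<equiv> J (unit_vec n)"

lemma J_add: "a \<in> c00 \<Longrightarrow> b \<in> c00 \<Longrightarrow> J (\<lambda>i. a i + b i) = J a + J b"
  and J_scale: "a \<in> c00 \<Longrightarrow> J (\<lambda>i. c * a i) = c *\<^sub>R J a"
  and norm_J: "a \<in> c00 \<Longrightarrow> norm (J a) = RN a"
  and closure_J: "closure (J ` c00) = Z"
  using completion by (auto simp: is_completion_def)

lemma J_diff:
  assumes "a \<in> c00" "b \<in> c00"
  shows "J (\<lambda>i. a i - b i) = J a - J b"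
  using J_add[OF assms(1) c00_mult[OF assms(2), of "\<lambda>_. -1"]] J_scale[OF assms(2), of "-1"] by simp

lemma J_in_Z: "a \<in> c00 \<Longrightarrow> J a \<in> Z"
  unfolding closure_J[symmetric] by (rule subsetD[OF closure_subset imageI])

lemma unit_vec_c00: "unit_vec n \<in> c00"
  by (rule c00I[of "{n}"]) (auto simp: unit_vec_def)

lemma J_finite:
  assumes "finite A"
  shows "J (\<lambda>k. if k \<in> A then a k else 0) = (\<Sum>k\<in>A. a k *\<^sub>R e k)"
  using assms
proof (induction A rule: finite_induct)
  case empty
  show ?case using J_scale[OF unit_vec_c00, of 0] by simp
next
  case (insert n A)
  have "J (\<lambda>k. if k \<in> insert n A then a k else 0)
      = J (\<lambda>k. a n * unit_vec n k + (if k \<in> A then a k else 0))"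
    using insert.hyps by (intro arg_cong[of _ _ J]) (auto simp: unit_vec_def fun_eq_iff)
  also have "\<dots> = J (\<lambda>k. a n * unit_vec n k) + J (\<lambda>k. if k \<in> A then a k else 0)"
    using insert.hyps by (intro J_add c00_mult unit_vec_c00 c00I[of A]) simp_all
  also have "\<dots> = (\<Sum>k\<in>insert n A. a k *\<^sub>R e k)"
    unfolding J_scale[OF unit_vec_c00] insert.IH using insert.hyps by simp
  finally show ?case .
qed

lemma J_cut: "J (\<lambda>k. if k < n then a k else 0) = (\<Sum>k<n. a k *\<^sub>R e k)"
  using J_finite[of "{..<n}" a] by simp

lemma closure_span_e: "closure (span (range e)) = Z"
proof -
  have "span (range e) \<subseteq> J ` c00"
  proof
    fix v assume "v \<in> span (range e)"
    then obtain a n where "v = (\<Sum>i<n. a i *\<^sub>R e i)" by (rule span_range_finite_sum)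
    then have "v = J (\<lambda>k. if k < n then a k else 0)" by (simp add: J_cut)
    then show "v \<in> J ` c00" using c00_cut by blast
  qed
  moreover have "J ` c00 \<subseteq> span (range e)"
  proof
    fix v assume "v \<in> J ` c00"
    then obtain a where a: "a \<in> c00" "v = J a" by blast
    have "a = (\<lambda>k. if k \<in> supp a then a k else 0)" by (auto simp: supp_def)
    then have "v = (\<Sum>k\<in>supp a. a k *\<^sub>R e k)"
      using a J_finite[of "supp a" a] by (simp add: c00_def)
    also have "\<dots> \<in> span (range e)" by (intro span_sum span_scale span_base rangeI)
    finally show "v \<in> span (range e)" .
  qed
  ultimately show ?thesis using closure_J by (simp add: subset_antisym)
qed

section \<open>The unit vectors form an RUC basis\<close>

lemma schauder_basis_e: "schauder_basis Z e"
proof -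
  have "schauder_basis (closure (span (range e))) e"
  proof (rule schauder_basisI_projections[where K = 1])
    fix n
    have "1 \<le> MR (unit_vec n)" using abs_le_MR[OF unit_vec_c00, of n n] by (simp add: unit_vec_def)
    also have "\<dots> \<le> norm (e n)" using MR_le_RUC_norm[OF unit_vec_c00] by (simp add: norm_J unit_vec_c00)
    finally show "e n \<noteq> 0" by auto
  next
    fix a :: "nat \<Rightarrow> real" and p q :: nat assume "p \<le> q"
    then have "(\<lambda>k. if k < p then a k else 0) = (\<lambda>k. if k < p then if k < q then a k else 0 else 0)"
      by auto
    then show "norm (\<Sum>i<p. a i *\<^sub>R e i) \<le> 1 * norm (\<Sum>i<q. a i *\<^sub>R e i)"
      using RUC_norm_cut_le[OF c00_cut[of q a], of p] by (simp add: J_cut[symmetric] norm_J c00_cut)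
  qed
  then show ?thesis by (simp add: closure_span_e)
qed

lemma RUC_e: "RUC e"
  unfolding RUC_def basic_sequence_def closure_span_e
proof (intro conjI schauder_basis_e exI allI)
  fix n and a :: "nat \<Rightarrow> real"
  let ?a = "\<lambda>i. if i < n then a i else 0"
  have "norm (\<Sum>i<n. \<epsilon> i *\<^sub>R a i *\<^sub>R e i) = RN (\<lambda>i. \<epsilon> i * ?a i)" for \<epsilon>
  proof -
    have "(\<Sum>i<n. \<epsilon> i *\<^sub>R a i *\<^sub>R e i) = J (\<lambda>i. if i < n then \<epsilon> i * a i else 0)"
      by (simp add: J_cut)
    also have "(\<lambda>i. if i < n then \<epsilon> i * a i else 0) = (\<lambda>i. \<epsilon> i * ?a i)" by auto
    finally show ?thesis using c00_mult[OF c00_cut] by (simp add: norm_J)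
  qed
  moreover have "sign_avg {..<n} (\<lambda>\<epsilon>. RN (\<lambda>i. \<epsilon> i * ?a i)) \<le> 2 * RN ?a"
    by (rule sign_avg_RUC_norm_le) (auto simp: supp_def)
  moreover have "RN ?a = norm (\<Sum>i<n. a i *\<^sub>R e i)"
    by (simp add: J_cut[symmetric] norm_J c00_cut)
  ultimately show "sign_avg {..<n} (\<lambda>\<epsilon>. norm (\<Sum>i<n. \<epsilon> i *\<^sub>R a i *\<^sub>R e i))
      \<le> 2 * norm (\<Sum>i<n. a i *\<^sub>R e i)" by simp
qed

section \<open>The unit vectors are weakly null\<close>

lemma bounded_functional_sum:
  assumes f: "bounded_functional_on Z f" and A: "finite A"
  shows "f (\<Sum>k\<in>A. c k *\<^sub>R e k) = (\<Sum>k\<in>A. c k * f (e k))"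
  using A
proof (induction A rule: finite_induct)
  case empty
  have "f (0 *\<^sub>R e 0) = 0 * f (e 0)"
    using f J_in_Z[OF unit_vec_c00] unfolding bounded_functional_on_def by blast
  then show ?case by simp
next
  case (insert n A)
  have "(\<Sum>k\<in>A. c k *\<^sub>R e k) \<in> Z"
    unfolding J_finite[OF insert.hyps(1), symmetric] using insert.hyps by (intro J_in_Z c00I) auto
  moreover have "c n *\<^sub>R e n \<in> Z"
    unfolding J_scale[OF unit_vec_c00, symmetric] by (intro J_in_Z c00_mult unit_vec_c00)
  ultimately have "f (c n *\<^sub>R e n + (\<Sum>k\<in>A. c k *\<^sub>R e k)) = f (c n *\<^sub>R e n) + f (\<Sum>k\<in>A. c k *\<^sub>R e k)"
    using f unfolding bounded_functional_on_def by blast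
  moreover have "f (c n *\<^sub>R e n) = c n * f (e n)"
    using f J_in_Z[OF unit_vec_c00] unfolding bounded_functional_on_def by blast
  ultimately show ?case using insert by simp
qed

lemma weakly_null_e: "weakly_null Z e"
  unfolding weakly_null_def
proof (intro allI impI)
  fix f assume f: "bounded_functional_on Z f"
  obtain K where K: "\<And>x. x \<in> Z \<Longrightarrow> \<bar>f x\<bar> \<le> K * norm x"
    using f unfolding bounded_functional_on_def by blast
  show "(\<lambda>n. f (e n)) \<longlonglongrightarrow> 0"
  proof (rule LIMSEQ_I, rule ccontr)
    fix \<eta> :: real assume \<eta>: "0 < \<eta>" and "\<nexists>n0. \<forall>n\<ge>n0. norm (f (e n) - 0) < \<eta>"
    then have "\<forall>n0. \<exists>n\<ge>n0. \<eta> \<le> \<bar>f (e n)\<bar>" by (simp add: not_less)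
    then have inf: "infinite {n. \<eta> \<le> \<bar>f (e n)\<bar>}" unfolding infinite_nat_iff_unbounded_le by simp
    obtain p :: nat where p: "(4 * K / \<eta>)\<^sup>2 < p" using reals_Archimedean2 by blast
    have "real p \<le> m p" using le_m[of p] by simp
    with p have big: "4 * K / \<eta> < sqrt (m p)" by (intro real_less_rsqrt) simp
    obtain A where A: "finite A" "card A = m p" "A \<subseteq> {n. \<eta> \<le> \<bar>f (e n)\<bar>}"
      using infinite_arbitrarily_large[OF inf] by blast
    define v where "v = (\<Sum>k\<in>A. sgn (f (e k)) *\<^sub>R e k)"
    have v: "v = J (\<lambda>k. if k \<in> A then sgn (f (e k)) else 0)"
      unfolding v_def J_finite[OF A(1)] ..
    have c: "(\<lambda>k. if k \<in> A then sgn (f (e k)) else 0) \<in> c00" using A(1) by (rule c00I) simp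
    have "norm v \<le> 4 * sqrt (m p)"
      unfolding v norm_J[OF c] using A by (intro RUC_norm_flat_le) (auto simp: sgn_if)
    have K0: "0 \<le> K"
    proof -
      have "0 \<le> K * norm (e 0)" using K[OF J_in_Z[OF unit_vec_c00, of 0]] by linarith
      moreover have "e 0 \<noteq> 0"
        using MR_le_RUC_norm[OF unit_vec_c00, of 0] abs_le_MR[OF unit_vec_c00, of 0 0]
          norm_J[OF unit_vec_c00, of 0] by (auto simp: unit_vec_def)
      ultimately show ?thesis by (simp add: zero_le_mult_iff)
    qed
    have "sqrt (m p) * (sqrt (m p) * \<eta>) = card A * \<eta>" using A(2) by simp
    also have "\<dots> = (\<Sum>k\<in>A. \<eta>)" by simp
    also have "\<dots> \<le> (\<Sum>k\<in>A. \<bar>f (e k)\<bar>)" using A(3) by (intro sum_mono) auto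
    also have "\<dots> = f v"
      unfolding v_def bounded_functional_sum[OF f A(1)] by (simp add: abs_sgn mult.commute)
    also have "\<dots> \<le> K * norm v" using K[of v] J_in_Z[OF c] v by simp
    also have "\<dots> \<le> K * (4 * sqrt (m p))" using \<open>norm v \<le> 4 * sqrt (m p)\<close> K0 by (intro mult_left_mono)
    also have "\<dots> = sqrt (m p) * (4 * K)" by simp
    finally have "sqrt (m p) * \<eta> \<le> 4 * K" using m_pos[of p] by simp
    then show False using big \<eta> by (simp add: field_simps)
  qed
qed

section \<open>No subsequence is unconditional\<close>

text \<open>
  Spread the alternating harmonic coefficients over an infinite chain in the range of the subsequence.
  Tails of the resulting series are controlled by tails of the partial sums of the coefficients, so the
  series converges.  The subseries of positive terms does not: the functionals of the chain take on
  its partial sums the partial sums of the positive coefficients, which are unbounded.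
\<close>

lemma conditionally_convergent_subseries:
  fixes r :: "nat \<Rightarrow> nat"
  assumes r: "strict_mono r"
  obtains \<alpha> where "summable (\<lambda>i. \<alpha> i *\<^sub>R e (r i))" "\<not> (\<lambda>i. \<alpha> i *\<^sub>R e (r i)) summable_on UNIV"
proof -
  have "infinite (range r)" using r by (simp add: range_inj_infinite strict_mono_imp_inj_on)
  then obtain s where chain: "\<And>n. 0 < n \<Longrightarrow> chain s n" and s_r: "\<And>a. s a \<subseteq> range r"
    using infinite_chain_exists by blast
  have fin: "finite (s a)" and ne: "s a \<noteq> {}" for a
    using chain_finite[OF chain, of "Suc a" a] chain_nonempty[OF chain, of "Suc a" a] by simp_all
  have less: "x < y" if "a < b" "x \<in> s a" "y \<in> s b" for a b x y
    using chain_less[OF chain, of "Suc b" a b] that by simp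
  have disj: "a = b" if "x \<in> s a" "x \<in> s b" for a b x
    using less that by (metis less_irrefl nat_neq_iff)
  have block_val: "block s d n k = (if a < n then d a / sqrt (card (s a)) else 0)"
    if "k \<in> s a" for d n k a
  proof (cases "a < n")
    case True
    then show ?thesis using block_eq[OF chain, of n a k] that by simp
  next
    case False
    then have "k \<notin> (\<Union>b<n. s b)" using disj that by blast
    then show ?thesis using False block_outside by simp
  qed
  have block_zero: "block s d n k = 0" if "k \<notin> (\<Union>a. s a)" for d n k
    using that by (intro block_outside) blast
  define M where "M n = Min (s n)" for n
  have M: "M n \<in> s n" for n using fin ne by (simp add: M_def)
  have below: "k < M n \<longleftrightarrow> a < n" if "k \<in> s a" for k a n
  proof (cases a n rule: linorder_cases)
    case equal
    then show ?thesis using that fin by (simp add: M_def not_less)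
  qed (use less that M in \<open>force+\<close>)
  have M_mono: "strict_mono M" using less M by (auto simp: strict_mono_def)
  have M_ge: "n \<le> M n" for n using M_mono by (rule strict_mono_imp_increasing)

  define c :: "nat \<Rightarrow> real" where "c n = (-1) ^ n * inverse (Suc n)" for n
  have c_summable: "summable c"
    unfolding c_def using LIMSEQ_inverse_real_of_nat
    by (intro summable_Leibniz(1)) (auto simp: monoseq_Suc field_simps)
  have c_not_abs: "\<not> summable (\<lambda>n. \<bar>c n\<bar>)"
  proof
    assume "summable (\<lambda>n. \<bar>c n\<bar>)"
    then have "summable (\<lambda>n. inverse (real (Suc n)))" by (simp add: c_def abs_mult power_abs)
    then have "summable (\<lambda>n. inverse (real n))" by (subst (asm) summable_Suc_iff)
    then show False using not_summable_harmonic[where 'a = real] by simp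
  qed

  \<comment> \<open>A point of the a-th set is at least a, so the first k + 1 sets determine the coefficient at k.\<close>
  define \<alpha> where "\<alpha> k = block s c (Suc k) k" for k
  have \<alpha>: "\<alpha> k = c a / sqrt (card (s a))" if "k \<in> s a" for k a
  proof -
    have "a \<le> M a" by (rule M_ge)
    also have "M a \<le> k" using that fin by (simp add: M_def)
    finally show ?thesis using that by (simp add: \<alpha>_def block_val)
  qed
  have \<alpha>0: "\<alpha> k = 0" if "k \<notin> (\<Union>a. s a)" for k
    using that by (simp add: \<alpha>_def block_zero)
  have in_r: "\<alpha> k = 0" if "k \<notin> range r" for k
    using that s_r by (intro \<alpha>0) blast

  define T where "T p = (\<lambda>k. if k < p then \<alpha> k else 0)" for p
  have T: "T p \<in> c00" for p unfolding T_def by (rule c00_cut)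
  \<comment> \<open>Partial sums are only compared with those ending at a complete block; cuts inside a block are contractions.\<close>
  have close: "norm (J (T p) - J (T (M q))) \<le> 21 * B"
    if "M q \<le> p" and B: "\<And>l. \<bar>sum c {q..<l}\<bar> \<le> B" for p q B
  proof -
    define d where "d a = (if q \<le> a then c a else 0)" for a
    define n where "n = Suc p"
    have n: "0 < n" "p \<le> M n" using M_ge[of n] by (auto simp: n_def)
    have eq: "(\<lambda>k. T p k - T (M q) k) = (\<lambda>k. if k < p then block s d n k else 0)"
    proof
      fix k
      show "T p k - T (M q) k = (if k < p then block s d n k else 0)"
      proof (cases "k \<in> (\<Union>a. s a)")
        case True
        then obtain a where a: "k \<in> s a" by blast
        have "a < n" if "k < p" using that n below[OF a, of n] by simp
        moreover have "k < p" if "a < q" using that \<open>M q \<le> p\<close> below[OF a, of q] by simp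
        ultimately show ?thesis
          using \<alpha>[OF a] by (simp add: T_def block_val[OF a] below[OF a] d_def)
      next
        case False
        then show ?thesis by (simp add: T_def \<alpha>0 block_zero)
      qed
    qed
    have "norm (J (T p) - J (T (M q))) = RN (\<lambda>k. T p k - T (M q) k)"
      using J_diff[OF T T, of p "M q"] norm_J[OF c00_cut] eq by metis
    also have "\<dots> \<le> RN (block s d n)"
      unfolding eq by (intro RUC_norm_cut_le block_c00 chain n)
    also have "\<dots> \<le> 21 * B"
    proof (rule RUC_norm_block_le[OF chain[OF n(1)]])
      fix l
      have "sum d {..<l} = sum c {q..<l}"
        unfolding d_def by (simp add: sum.If_cases) (intro sum.cong, auto)
      then show "\<bar>sum d {..<l}\<bar> \<le> B" using B by simp
    qed
    finally show ?thesis .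
  qed
  have partial: "(\<Sum>i<p. \<alpha> (r i) *\<^sub>R e (r i)) = J (T (r p))" for p
  proof -
    have "(\<Sum>i<p. \<alpha> (r i) *\<^sub>R e (r i)) = (\<Sum>k\<in>r ` {..<p}. \<alpha> k *\<^sub>R e k)"
      by (subst sum.reindex) (use r in \<open>auto intro: strict_mono_imp_inj_on\<close>)
    also have "\<dots> = (\<Sum>k<r p. \<alpha> k *\<^sub>R e k)"
    proof (rule sum.mono_neutral_left)
      show "\<forall>k\<in>{..<r p} - r ` {..<p}. \<alpha> k *\<^sub>R e k = 0"
        using in_r r by (auto simp: strict_mono_less image_iff)
          (metis imageE lessThan_iff in_r strict_mono_less)
    qed (use r in \<open>auto simp: strict_mono_less\<close>)
    finally show ?thesis by (simp add: J_cut T_def)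
  qed
  have "Cauchy (\<lambda>p. J (T (r p)))"
  proof (rule metric_CauchyI)
    fix \<eta> :: real assume "0 < \<eta>"
    \<comment> \<open>With the constant 21 of the block estimate, each of two comparisons costs a quarter of the allowance.\<close>
    then have "0 < \<eta> / 84" by simp
    then obtain q where q: "\<And>l. \<bar>sum c {q..<l}\<bar> < \<eta> / 84"
      using c_summable unfolding summable_Cauchy by (metis order_refl real_norm_def)
    have *: "dist (J (T (r p))) (J (T (M q))) \<le> \<eta> / 4" if "M q \<le> p" for p
    proof -
      have "M q \<le> r p" using that strict_mono_imp_increasing[OF r, of p] by simp
      from close[OF this, of "\<eta> / 84"] show ?thesis
        using q by (simp add: dist_norm less_imp_le)
    qed
    have "dist (J (T (r p))) (J (T (r p'))) < \<eta>" if "M q \<le> p" "M q \<le> p'" for p p'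
      using dist_triangle2[of "J (T (r p))" "J (T (r p'))" "J (T (M q))"] *[OF that(1)] *[OF that(2)]
        \<open>0 < \<eta>\<close> by linarith
    then show "\<exists>p0. \<forall>p\<ge>p0. \<forall>p'\<ge>p0. dist (J (T (r p))) (J (T (r p'))) < \<eta>" by blast
  qed
  then have summable: "summable (\<lambda>i. \<alpha> (r i) *\<^sub>R e (r i))"
    unfolding summable_iff_convergent partial by (rule Cauchy_convergent)

  let ?f = "\<lambda>i. \<alpha> (r i) *\<^sub>R e (r i)"
  have "\<not> ?f summable_on UNIV"
  proof
    assume "?f summable_on UNIV"
    define P where "P = {i. 0 < \<alpha> (r i)}"
    have "?f summable_on P"
      using \<open>?f summable_on UNIV\<close> by (rule summable_on_subset_banach) simp
    then obtain v where "(?f has_sum v) P" by (auto simp: summable_on_def)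
    then have "\<forall>\<^sub>F Y in finite_subsets_at_top P. dist (sum ?f Y) v < 1"
      unfolding has_sum_def by (rule tendstoD) simp
    then obtain X where X: "finite X" "X \<subseteq> P"
      and near: "\<forall>Y. finite Y \<and> X \<subseteq> Y \<and> Y \<subseteq> P \<longrightarrow> dist (sum ?f Y) v < 1"
      unfolding eventually_finite_subsets_at_top by (elim exE conjE)
    obtain n0 where n0: "\<And>i. i \<in> X \<Longrightarrow> r i < n0"
      using X(1) finite_nat_set_iff_bounded[of "r ` X"] by auto
    define d where "d a = max (c a) 0" for a
    have bound: "sum d {..<n} \<le> norm v + 1" if n: "n0 < n" for n
    proof -
      define Y where "Y = {i \<in> P. r i < M n}"
      have "r ` Y \<subseteq> {..<M n}" by (auto simp: Y_def)
      then have finY: "finite Y"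
        using finite_imageD[OF _ strict_mono_imp_inj_on[OF r]] finite_subset by blast
      have XY: "X \<subseteq> Y"
      proof
        fix i assume i: "i \<in> X"
        have "r i < n" using n0[OF i] n by simp
        also have "n \<le> M n" by (rule M_ge)
        finally show "i \<in> Y" using i X(2) by (auto simp: Y_def)
      qed
      have eq: "(\<lambda>k. if k \<in> r ` Y then \<alpha> k else 0) = block s d n"
      proof
        fix k
        show "(if k \<in> r ` Y then \<alpha> k else 0) = block s d n k"
        proof (cases "k \<in> (\<Union>a. s a)")
          case True
          then obtain a where a: "k \<in> s a" by blast
          have pos: "0 < sqrt (card (s a))" using fin ne by (simp add: card_gt_0_iff)
          have "k \<in> r ` Y \<longleftrightarrow> 0 < \<alpha> k \<and> k < M n"
            using a s_r[of a] by (auto simp: Y_def P_def)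
          also have "\<dots> \<longleftrightarrow> 0 < c a \<and> a < n"
            using \<alpha>[OF a] below[OF a] pos by (simp add: zero_less_divide_iff)
          finally show ?thesis using \<alpha>[OF a] by (simp add: block_val[OF a] d_def max_def)
        next
          case False
          then show ?thesis by (simp add: \<alpha>0 block_zero)
        qed
      qed
      have n': "0 < n" using n by simp
      have "sum d {..<n} = chain_fun s n (block s d n)" by (simp add: chain_fun_block[OF chain[OF n']])
      also have "\<dots> \<le> MR (block s d n)"
        using chain_fun_le_MR[OF block_c00 chain] chain n' by (meson abs_ge_self order_trans)
      also have "\<dots> \<le> norm (J (block s d n))"
        using MR_le_RUC_norm norm_J block_c00[OF chain[OF n']] by metis
      also have "J (block s d n) = (\<Sum>k\<in>r ` Y. \<alpha> k *\<^sub>R e k)"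
        unfolding eq[symmetric] using finY by (intro J_finite) simp
      also have "\<dots> = sum ?f Y"
        using r by (subst sum.reindex) (auto intro: inj_on_subset strict_mono_imp_inj_on)
      also have "norm \<dots> \<le> norm v + 1"
      proof -
        have "norm (sum ?f Y - v) < 1"
          using near finY XY by (simp add: dist_norm Y_def)
        then show ?thesis using norm_triangle_sub[of "sum ?f Y" v] by simp
      qed
      finally show ?thesis .
    qed
    have d: "0 \<le> d a" for a by (simp add: d_def)
    have "summable d"
    proof (rule summableI_nonneg_bounded[OF d])
      fix n
      have "sum d {..<n} \<le> sum d {..<Suc (n0 + n)}" using d by (intro sum_mono2) auto
      also have "\<dots> \<le> norm v + 1" by (rule bound) simp
      finally show "sum d {..<n} \<le> norm v + 1" .
    qed
    then have "summable (\<lambda>a. 2 * d a - c a)"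
      using c_summable by (intro summable_diff summable_mult)
    also have "(\<lambda>a. 2 * d a - c a) = (\<lambda>a. \<bar>c a\<bar>)" by (auto simp: d_def)
    finally show False using c_not_abs by simp
  qed
  with summable show ?thesis by (rule that)
qed

end

theorem theorem4p3:
  fixes \<delta> :: real and m :: "nat \<Rightarrow> nat" and \<sigma> :: "nat set \<Rightarrow> nat"
    and J :: "(nat \<Rightarrow> real) \<Rightarrow> 'a::banach" and Z :: "'a set"
  assumes "0 < \<delta>" and "\<delta> < 1"
    and "strict_mono m" and "\<And>n. 0 < m n" and "lacunary m \<delta>"
    and "inj_on \<sigma> {s. finite s}"
    and "\<And>s. finite s \<Longrightarrow> \<sigma> s \<in> m ` {1..}"
    and "\<And>s. finite s \<Longrightarrow> card s < \<sigma> s"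
    and "is_completion (RUC_norm m \<sigma>) J Z"
  shows "weakly_null Z (\<lambda>n. J (unit_vec n)) \<and>
    schauder_basis Z (\<lambda>n. J (unit_vec n)) \<and>
    RUC (\<lambda>n. J (unit_vec n)) \<and>
    \<not> (\<exists>r :: nat \<Rightarrow> nat. strict_mono r \<and>
         unconditional_basic_sequence (\<lambda>n. J (unit_vec (r n))))"
proof -
  interpret RUC_completion \<delta> m \<sigma> J Z
    by unfold_locales (use assms in blast)+
  have "\<not> unconditional_basic_sequence (\<lambda>n. J (unit_vec (r n)))" if "strict_mono r" for r :: "nat \<Rightarrow> nat"
    using conditionally_convergent_subseries[OF that]
    unfolding unconditional_basic_sequence_def by metis
  then show ?thesis using weakly_null_e schauder_basis_e RUC_e by blast
qed

end
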